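(* Let $G=\mathbb{Z}$ or $G=\mathbb{Z}/m\mathbb{Z}$ for some integer $m\ge2$, let $N\ge1$, let $1<p<\infty$ and $q=\tfrac{p}{p-1}$, and let $p^{*}=\max\{p,q\}$. Let $f,g:G^N\to\mathbb{C}$ be test functions, with heat extensions $\tilde f(\cdot,t)=e^{t\Delta}f$ and $\tilde g(\cdot,t)=e^{t\Delta}g$. Then $$2\sum_{i=1}^N\int_0^\infty\sum_{n\in G^N}|\partial_+^i\tilde f(n,t)|\,|\partial_+^i\tilde g(n,t)|\,dt\le(p^{*}-1)\,\|f\|_p\,\|g\|_q .$$
   Context: Test functions are finitely supported functions on $G^N$, and $\|\cdot\|_p$ is the $L^p$ norm with respect to counting measure on $G^N$. With $e_i\in G^N$ the element having the generator $1$ of $G$ in the $i$-th coordinate and $0$ elsewhere, $\partial_+^if(n)=f(n+e_i)-f(n)$, $\partial_-^if(n)=f(n)-f(n-e_i)$, acting in the variable $n$, and $\Delta=\sum_{i=1}^N\partial_+^i\partial_-^i$, i.e. $\Delta f(n)=\sum_i\big(f(n+e_i)-2f(n)+f(n-e_i)\big)$. The heat extension $\tilde f(n,t)=(e^{t\Delta}f)(n)$, $t\ge0$, solves $\partial_t\tilde f-\Delta\tilde f=0$ with $\tilde f(\cdot,0)=f$. *)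

theory Defs
  imports "HOL-Analysis.Analysis" "HOL-Algebra.Product_Groups"
begin

text \<open>
  The groups \<open>\<int>\<close> and \<open>\<int>/m\<int>\<close> are \<^const>\<open>integer_group\<close> and \<^const>\<open>integer_mod_group\<close> (with
  carrier \<open>{0..<m}\<close>); in both the generator is the integer \<open>1\<close>.  A function on \<open>G\<^sup>N\<close> is
  a function on \<open>nat \<Rightarrow> int\<close> of which only the values on the carrier of \<open>gpow N G\<close> are used.
\<close>

definition gpow :: "nat \<Rightarrow> int monoid \<Rightarrow> (nat \<Rightarrow> int) monoid"
  where "gpow N G = product_group {1..N} (\<lambda>_. G)"

definition unit_vec :: "nat \<Rightarrow> int monoid \<Rightarrow> nat \<Rightarrow> nat \<Rightarrow> int"
  where "unit_vec N G i = (\<lambda>j\<in>{1..N}. if j = i then 1 else \<one>\<^bsub>G\<^esub>)"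

definition fwd_diff ::
    "nat \<Rightarrow> int monoid \<Rightarrow> nat \<Rightarrow> ((nat \<Rightarrow> int) \<Rightarrow> complex) \<Rightarrow> (nat \<Rightarrow> int) \<Rightarrow> complex"
  where "fwd_diff N G i f n = f (n \<otimes>\<^bsub>gpow N G\<^esub> unit_vec N G i) - f n"

definition bwd_diff ::
    "nat \<Rightarrow> int monoid \<Rightarrow> nat \<Rightarrow> ((nat \<Rightarrow> int) \<Rightarrow> complex) \<Rightarrow> (nat \<Rightarrow> int) \<Rightarrow> complex"
  where "bwd_diff N G i f n =
    f n - f (n \<otimes>\<^bsub>gpow N G\<^esub> (inv\<^bsub>gpow N G\<^esub> unit_vec N G i))"

definition laplacian ::
    "nat \<Rightarrow> int monoid \<Rightarrow> ((nat \<Rightarrow> int) \<Rightarrow> complex) \<Rightarrow> (nat \<Rightarrow> int) \<Rightarrow> complex"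
  where "laplacian N G f n = (\<Sum>i=1..N. fwd_diff N G i (bwd_diff N G i f) n)"

definition test_function :: "nat \<Rightarrow> int monoid \<Rightarrow> ((nat \<Rightarrow> int) \<Rightarrow> complex) \<Rightarrow> bool"
  where "test_function N G f \<longleftrightarrow> finite {n \<in> carrier (gpow N G). f n \<noteq> 0}"

definition Lp_norm :: "nat \<Rightarrow> int monoid \<Rightarrow> real \<Rightarrow> ((nat \<Rightarrow> int) \<Rightarrow> complex) \<Rightarrow> real"
  where "Lp_norm N G p f =
    (\<integral>n. norm (f n) powr p \<partial>count_space (carrier (gpow N G))) powr (1 / p)"

text \<open>
  The exponential series of the bounded operator \<open>t\<Delta>\<close>, evaluated pointwise.  It converges
  for every function that is bounded on \<open>G\<^sup>N\<close>; the lemmas below check this and the heat equation.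
\<close>

definition heat_ext ::
    "nat \<Rightarrow> int monoid \<Rightarrow> ((nat \<Rightarrow> int) \<Rightarrow> complex) \<Rightarrow> real \<Rightarrow> (nat \<Rightarrow> int) \<Rightarrow> complex"
  where "heat_ext N G f t n = (\<Sum>k. (t ^ k / fact k) *\<^sub>R (laplacian N G ^^ k) f n)"

lemma group_gpow: "group G \<Longrightarrow> group (gpow N G)"
  by (simp add: gpow_def)

lemma unit_vec_closed:
  assumes "group G" "1 \<in> carrier G"
  shows "unit_vec N G i \<in> carrier (gpow N G)"
  using assms by (auto simp: gpow_def unit_vec_def group.is_monoid monoid.one_closed)

lemma laplacian_eq:
  assumes "group G" "1 \<in> carrier G" "n \<in> carrier (gpow N G)"
  shows "laplacian N G f n = (\<Sum>i=1..N.
    f (n \<otimes>\<^bsub>gpow N G\<^esub> unit_vec N G i) - 2 * f n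
      + f (n \<otimes>\<^bsub>gpow N G\<^esub> (inv\<^bsub>gpow N G\<^esub> unit_vec N G i)))"
proof -
  interpret H: group "gpow N G" by (rule group_gpow[OF assms(1)])
  have "n \<otimes>\<^bsub>gpow N G\<^esub> unit_vec N G i \<otimes>\<^bsub>gpow N G\<^esub> (inv\<^bsub>gpow N G\<^esub> unit_vec N G i) = n" for i
    using assms unit_vec_closed[OF assms(1,2)] by (simp add: H.m_assoc)
  then show ?thesis
    by (simp add: laplacian_def fwd_diff_def bwd_diff_def algebra_simps)
qed

lemma norm_laplacian_power_le:
  assumes G: "group G" "1 \<in> carrier G"
    and C: "\<And>n. n \<in> carrier (gpow N G) \<Longrightarrow> norm (f n) \<le> C"
    and n: "n \<in> carrier (gpow N G)"
  shows "norm ((laplacian N G ^^ k) f n) \<le> (4 * real N) ^ k * C"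
  using n
proof (induction k arbitrary: n)
  case 0
  then show ?case using C by simp
next
  case (Suc k)
  interpret H: group "gpow N G" by (rule group_gpow[OF G(1)])
  let ?h = "(laplacian N G ^^ k) f" and ?B = "(4 * real N) ^ k * C"
  note e = unit_vec_closed[OF G, of N]
  have "norm (?h (n \<otimes>\<^bsub>gpow N G\<^esub> unit_vec N G i) - 2 * ?h n
      + ?h (n \<otimes>\<^bsub>gpow N G\<^esub> (inv\<^bsub>gpow N G\<^esub> unit_vec N G i))) \<le> 4 * ?B" for i
  proof -
    have "norm (?h (n \<otimes>\<^bsub>gpow N G\<^esub> unit_vec N G i)) \<le> ?B" "norm (2 * ?h n) \<le> 2 * ?B"
      "norm (?h (n \<otimes>\<^bsub>gpow N G\<^esub> (inv\<^bsub>gpow N G\<^esub> unit_vec N G i))) \<le> ?B"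
      using Suc e[of i] by (simp_all add: norm_mult)
    then show ?thesis
      by (intro norm_triangle_le) (smt (verit) norm_triangle_ineq4)
  qed
  then have "norm (laplacian N G ?h n) \<le> (\<Sum>i=1..N. 4 * ?B)"
    unfolding laplacian_eq[OF G Suc.prems] by (intro sum_norm_le)
  then show ?case by (simp add: algebra_simps)
qed

lemma test_function_bounded:
  assumes "test_function N G f"
  obtains C where "\<And>n. n \<in> carrier (gpow N G) \<Longrightarrow> norm (f n) \<le> C"
proof
  fix n assume n: "n \<in> carrier (gpow N G)"
  let ?S = "{n \<in> carrier (gpow N G). f n \<noteq> 0}"
  show "norm (f n) \<le> (\<Sum>m\<in>?S. norm (f m))"
  proof (cases "f n = 0")
    case False
    then show ?thesis
      using assms n by (intro member_le_sum) (auto simp: test_function_def)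
  qed (simp add: sum_nonneg)
qed

lemma summable_heat_ext:
  assumes G: "group G" "1 \<in> carrier G" and f: "test_function N G f"
    and n: "n \<in> carrier (gpow N G)"
  shows "summable (\<lambda>k. (laplacian N G ^^ k) f n / fact k * (z :: complex) ^ k)"
proof -
  obtain C where C: "\<And>n. n \<in> carrier (gpow N G) \<Longrightarrow> norm (f n) \<le> C"
    using test_function_bounded[OF f] by metis
  show ?thesis
  proof (rule summable_comparison_test)
    have "norm ((laplacian N G ^^ k) f n / fact k * z ^ k)
        \<le> C * ((4 * real N * norm z) ^ k /\<^sub>R fact k)" for k
    proof -
      have "norm ((laplacian N G ^^ k) f n) \<le> (4 * real N) ^ k * C"
        using C by (intro norm_laplacian_power_le G n)
      from mult_right_mono[OF this, of "norm z ^ k / fact k"] show ?thesis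
        by (simp add: norm_mult norm_divide norm_power power_mult_distrib field_simps)
    qed
    then show "\<exists>K. \<forall>k\<ge>K. norm ((laplacian N G ^^ k) f n / fact k * z ^ k)
        \<le> C * ((4 * real N * norm z) ^ k /\<^sub>R fact k)" by blast
    show "summable (\<lambda>k. C * ((4 * real N * norm z) ^ k /\<^sub>R fact k))"
      by (intro summable_mult summable_exp_generic)
  qed
qed

lemma heat_ext_eq:
  "heat_ext N G f t n = (\<Sum>k. (laplacian N G ^^ k) f n / fact k * complex_of_real t ^ k)"
  by (simp add: heat_ext_def scaleR_conv_of_real mult_ac)

lemma heat_ext_0: "heat_ext N G f 0 n = f n"
  using powser_zero[of "\<lambda>k. (laplacian N G ^^ k) f n / fact k"] by (simp add: heat_ext_eq)

lemma heat_equation: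
  assumes G: "group G" "1 \<in> carrier G" and f: "test_function N G f"
    and n: "n \<in> carrier (gpow N G)"
  shows "((\<lambda>t. heat_ext N G f t n) has_vector_derivative laplacian N G (heat_ext N G f t) n) (at t)"
proof -
  interpret H: group "gpow N G" by (rule group_gpow[OF G(1)])
  let ?a = "\<lambda>k m. (laplacian N G ^^ k) f m" and ?z = "complex_of_real t"
  have S: "(\<lambda>k. ?a k m / fact k * ?z ^ k) sums heat_ext N G f t m" if "m \<in> carrier (gpow N G)" for m
    unfolding heat_ext_eq using summable_heat_ext[OF G f that] by (rule summable_sums)
  have D: "diffs (\<lambda>k. ?a k n / fact k) = (\<lambda>k. ?a (Suc k) n / fact k)"
    by (rule ext) (simp add: diffs_def divide_simps del: of_nat_Suc funpow.simps)
  have "(\<lambda>k. laplacian N G (?a k) n / fact k * ?z ^ k) sums laplacian N G (heat_ext N G f t) n"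
  proof -
    have "(\<lambda>k. (\<Sum>i=1..N. ?a k (n \<otimes>\<^bsub>gpow N G\<^esub> unit_vec N G i) / fact k * ?z ^ k
        - 2 * (?a k n / fact k * ?z ^ k)
        + ?a k (n \<otimes>\<^bsub>gpow N G\<^esub> (inv\<^bsub>gpow N G\<^esub> unit_vec N G i)) / fact k * ?z ^ k))
        sums laplacian N G (heat_ext N G f t) n"
      unfolding laplacian_eq[OF G n, of "heat_ext N G f t"]
      using unit_vec_closed[OF G, of N] n
      by (intro sums_sum sums_add sums_diff sums_mult S) auto
    moreover have "laplacian N G (?a k) n / fact k * ?z ^ k =
        (\<Sum>i=1..N. ?a k (n \<otimes>\<^bsub>gpow N G\<^esub> unit_vec N G i) / fact k * ?z ^ k
        - 2 * (?a k n / fact k * ?z ^ k)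
        + ?a k (n \<otimes>\<^bsub>gpow N G\<^esub> (inv\<^bsub>gpow N G\<^esub> unit_vec N G i)) / fact k * ?z ^ k)" for k
      unfolding laplacian_eq[OF G n] sum_divide_distrib sum_distrib_right
      by (intro sum.cong refl) (simp add: field_simps)
    ultimately show ?thesis by simp
  qed
  then have "(\<Sum>k. diffs (\<lambda>k. ?a k n / fact k) k * ?z ^ k) = laplacian N G (heat_ext N G f t) n"
    by (simp add: D sums_iff)
  then have "((\<lambda>z. \<Sum>k. ?a k n / fact k * z ^ k) has_field_derivative
      laplacian N G (heat_ext N G f t) n) (at ?z)"
    using termdiffs_strong_converges_everywhere[OF summable_heat_ext[OF G f n], of ?z] by metis
  then show ?thesis
    unfolding heat_ext_eq by (rule has_vector_derivative_real_field)
qed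

end

theory Submission
  imports Defs
begin

text \<open>
  By symmetry let \<open>p \<ge> 2\<close>.  Burkholder's function \<open>U (x, y) = (|y| - (p - 1) |x|) (|x| + |y|) powr (p - 1)\<close>
  lies below its tangent planes at all increments \<open>(h, k)\<close> with \<open>|k| \<le> |h|\<close>.  Put
  \<open>b (x, g) = max {y \<bullet> g - p powr (1 - p) U (x, y) | y}\<close>.  If \<open>y\<^sub>0\<close> is the maximiser at \<open>(x, g)\<close>, testing
  the maximum at \<open>(x + dx, g + dg)\<close> with \<open>y\<^sub>0 + k\<close>, where \<open>|k| = |dx|\<close> and \<open>k\<close> is parallel to \<open>dg\<close>, shows
  that \<open>b\<close> exceeds one of its supporting planes at \<open>(x, g)\<close> by at least \<open>|dx| |dg|\<close>.  Moreover
  \<open>0 \<le> b (x, g) \<le> (p - 1) (|x| powr p / p + |g| powr q / q)\<close>.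

  Summing the supporting plane inequality over the neighbours of a lattice point, and then over the group,
  the differences of \<open>b\<close> cancel by translation invariance, so that \<open>\<Sum>\<^sub>n b (f\<^sub>t n, g\<^sub>t n)\<close> decreases along the
  heat flow at rate at least \<open>2 \<Sum>\<^sub>i \<Sum>\<^sub>n |\<partial>\<^sub>i f\<^sub>t| |\<partial>\<^sub>i g\<^sub>t|\<close>.  As \<open>b\<close> is not known to be differentiable,
  this is done with backward time steps, where a supporting plane suffices.  Integration in time bounds
  the left-hand side by \<open>(p - 1) (\<parallel>f\<parallel> powr p / p + \<parallel>g\<parallel> powr q / q)\<close>, and replacing \<open>(f, g)\<close> by
  \<open>(c f, g / c)\<close> with the optimal \<open>c\<close> turns this sum into the product of the norms.
\<close>

section \<open>Burkholder's function\<close>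

lemma powr_ge_tangent:
  fixes z r :: real
  assumes "0 \<le> z" "1 \<le> r"
  shows "1 + r * (z - 1) \<le> z powr r"
proof (cases "r = 1")
  case False
  \<comment> \<open>Bernoulli's inequality is Young's inequality for \<open>z\<close> and 1 with
    exponent \<open>r\<close> and its conjugate.\<close>
  have "z * 1 \<le> z powr r / r + 1 powr (r / (r - 1)) / (r / (r - 1))"
    using assms False by (intro Youngs_inequality) (auto simp: field_simps)
  also have "\<dots> = (z powr r + (r - 1)) / r"
    by (simp add: add_divide_distrib)
  finally show ?thesis using assms by (simp add: pos_le_divide_eq algebra_simps)
qed (use assms in auto)

lemma powr_diff_one_le:
  fixes z p :: real
  assumes "0 \<le> z" "1 < p"
  shows "p * z powr (p - 1) \<le> 1 + (p - 1) * z powr p"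
proof -
  have "z powr (p - 1) * 1 \<le> (z powr (p - 1)) powr (p / (p - 1)) / (p / (p - 1)) + 1 powr p / p"
    using assms by (intro Youngs_inequality) (auto simp: field_simps)
  also have "(p - 1) * (p / (p - 1)) = p" using assms by simp
  then have "(z powr (p - 1)) powr (p / (p - 1)) / (p / (p - 1)) + 1 powr p / p = (1 + (p - 1) * z powr p) / p"
    by (simp add: powr_powr add_divide_distrib mult.commute)
  finally show ?thesis using assms by (simp add: pos_le_divide_eq algebra_simps)
qed

text \<open>The right-hand side is the second-order Taylor polynomial of \<open>z powr p\<close> at
  1. The difference vanishes at 1, and its derivative is nonpositive by Bernoulli's inequality with
  exponent \<open>p - 1\<close>.\<close>

lemma powr_le_quadratic:
  fixes z p :: real
  assumes "0 \<le> z" "z \<le> 1" "2 \<le> p"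
  shows "z powr p \<le> (p - 1) * (p - 2) / 2 - p * (p - 2) * z + p * (p - 1) / 2 * z\<^sup>2"
proof -
  let ?F = "\<lambda>z. (p - 1) * (p - 2) / 2 - p * (p - 2) * z + p * (p - 1) / 2 * z\<^sup>2 - z powr p"
  have "?F 1 \<le> ?F z"
  proof (rule DERIV_nonpos_imp_decreasing_open[OF assms(2)])
    fix x assume x: "z < x" "x < 1"
    have "(?F has_real_derivative (- p * (p - 2) + p * (p - 1) * x - p * x powr (p - 1))) (at x)"
      using x assms by (auto intro!: derivative_eq_intros)
    moreover have "p * (1 + (p - 1) * (x - 1)) \<le> p * x powr (p - 1)"
      using x assms by (intro mult_left_mono powr_ge_tangent) auto
    ultimately show "\<exists>y. (?F has_real_derivative y) (at x) \<and> y \<le> 0"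
      by (intro exI[of _ "- p * (p - 2) + p * (p - 1) * x - p * x powr (p - 1)"] conjI)
        (auto simp: algebra_simps)
  next
    show "continuous_on {z..1} ?F"
      using assms by (intro continuous_intros continuous_on_powr') auto
  qed
  moreover have "?F 1 = 0" by (simp add: field_simps)
  ultimately show ?thesis by simp
qed

text \<open>Equality holds at 1, and the derivative of the difference is \<open>p\<close> times the
  slack in \<open>powr_diff_one_le\<close> with \<open>p - 1\<close> in place of
  \<open>p\<close>.\<close>

lemma powr_ge_quotient:
  fixes z p :: real
  assumes "1 \<le> z" "2 \<le> p"
  shows "p * z powr (p - 1) + (p - 2) \<le> (p - 2) * z powr p + p * z"
proof -
  let ?F = "\<lambda>z. (p - 2) * z powr p - p * z powr (p - 1) + p * z"
  have "?F 1 \<le> ?F z"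
  proof (rule DERIV_nonneg_imp_increasing_open[OF assms(1)])
    fix x assume x: "1 < x" "x < z"
    have "(?F has_real_derivative ((p - 2) * (p * x powr (p - 1)) - p * ((p - 1) * x powr (p - 2)) + p)) (at x)"
      using x by (auto intro!: derivative_eq_intros simp: algebra_simps)
    moreover have "(p - 1) * x powr (p - 2) \<le> 1 + (p - 2) * x powr (p - 1)"
      using powr_diff_one_le[of x "p - 1"] x assms by (cases "p = 2") auto
    from mult_left_mono[OF this, of p] have "0 \<le> (p - 2) * (p * x powr (p - 1)) - p * ((p - 1) * x powr (p - 2)) + p"
      using assms by (simp add: algebra_simps)
    ultimately show "\<exists>y. (?F has_real_derivative y) (at x) \<and> 0 \<le> y" by blast
  next
    show "continuous_on {1..z} ?F"
      using assms by (intro continuous_intros) auto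
  qed
  then show ?thesis by simp
qed

section \<open>Burkholder's function and its tangent planes\<close>

definition burkholder :: "real \<Rightarrow> 'a::real_normed_vector \<Rightarrow> 'a \<Rightarrow> real"
  where "burkholder p x y = (norm y - (p - 1) * norm x) * (norm x + norm y) powr (p - 1)"

text \<open>Here \<open>z\<close> stands for \<open>R / r\<close> and \<open>w\<close> for \<open>z powr (p - 1)\<close>; after \<open>S = R - A\<close> the difference of the
  two sides is increasing in \<open>A\<close>, whose least admissible value is \<open>max 0 ((R - r) / 2)\<close>.\<close>
lemma zigzag_scalar:
  fixes p z w r A a D c :: real
  assumes p: "2 \<le> p" and z: "0 \<le> z" and w: "1 + (p - 1) * (z - 1) \<le> w"
    and small: "z \<le> 1 \<Longrightarrow> z * w \<le> (p - 1) * (p - 2) / 2 - p * (p - 2) * z + p * (p - 1) / 2 * z\<^sup>2"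
    and large: "1 \<le> z \<Longrightarrow> p * w + (p - 2) \<le> (p - 2) * (z * w) + p * z"
    and r: "0 < r" and A: "0 \<le> A" "z * r - r \<le> 2 * A"
    and D: "D \<le> z * r - A"
    and c: "(z * r - A)\<^sup>2 - A\<^sup>2 - 2 * (r - a) * D + (r - a)\<^sup>2 - a\<^sup>2 \<le> - 2 * c"
  shows "(z * r - p * A) * (w * r) \<le> (r - p * a) * r - p * (p - 1) * (c - a\<^sup>2)
          + p * (r - (p - 1) * a) * (D - (r - a))"
proof -
  \<comment> \<open>The right-hand side of the claim minus the left-hand side is exactly
    \<open>r\<^sup>2 * E + p * r * A * F\<close>, plus \<open>p * (p - 1) / 2\<close> times the
    slack in \<open>c\<close>, plus \<open>p * (p - 2) * r\<close> times the slack in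
    \<open>D\<close>.\<close>
  define E where "E = (p - 1) * (p - 2) / 2 - p * (p - 2) * z + p * (p - 1) / 2 * z\<^sup>2 - z * w"
  define F where "F = w - (p - 1) * z + (p - 2)"
  have F: "0 \<le> F" using w by (simp add: F_def algebra_simps)
  have "0 \<le> r\<^sup>2 * E + p * r * A * F"
  proof (cases "z \<le> 1")
    case True
    then show ?thesis using small A r p F by (simp add: E_def)
  next
    case False
    have "0 \<le> r\<^sup>2 * (((p - 2) * (z * w) + p * z - p * w - (p - 2)) / 2)"
      using large False by simp
    also have "\<dots> = r\<^sup>2 * E + p * r * F * ((z * r - r) / 2)"
      by (simp add: E_def F_def field_simps power2_eq_square)
    also have "p * r * F * ((z * r - r) / 2) \<le> p * r * F * A"
      using A F r p by (intro mult_left_mono) auto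
    finally show ?thesis by (simp add: mult_ac)
  qed
  moreover have "p * (p - 1) / 2 * ((z * r - A)\<^sup>2 - A\<^sup>2 - 2 * (r - a) * D + (r - a)\<^sup>2 - a\<^sup>2)
      \<le> p * (p - 1) / 2 * (- 2 * c)"
    using p c by (intro mult_left_mono) auto
  moreover have "p * (p - 2) * r * D \<le> p * (p - 2) * r * (z * r - A)"
    using p r D by (intro mult_left_mono) auto
  ultimately show ?thesis
    unfolding E_def F_def by (simp add: field_simps power2_eq_square)
qed

text \<open>The two slopes form the gradient of \<open>burkholder p\<close> at
  \<open>(x, y)\<close>; at \<open>y = 0\<close> the convention \<open>sgn 0 = 0\<close> selects the
  slope zero. Only the norms of \<open>X\<close> and \<open>Y\<close> and their inner products with
  \<open>x\<close> and \<open>sgn y\<close> enter, which reduces the claim to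
  \<open>zigzag_scalar\<close>.\<close>

lemma burkholder_zigzag:
  fixes x y X Y :: "'a::real_inner"
  assumes p: "2 \<le> p" and dom: "norm (Y - y) \<le> norm (X - x)"
  defines "r \<equiv> norm x + norm y"
  shows "burkholder p X Y \<le> burkholder p x y
    - p * (p - 1) * r powr (p - 2) * inner x (X - x)
    + p * r powr (p - 2) * (r - (p - 1) * norm x) * inner (sgn y) (Y - y)"
proof (cases "r = 0")
  case True
  then have xy: "x = 0" "y = 0"
    unfolding r_def using norm_ge_zero[of x] norm_ge_zero[of y] by (simp_all add: add_nonneg_eq_0_iff)
  then have "norm Y - (p - 1) * norm X \<le> 0"
    using dom p mult_right_mono[of 1 "p - 1" "norm X"] by simp
  then show ?thesis
    using True xy by (simp add: burkholder_def mult_nonpos_nonneg)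
next
  case False
  then have r: "0 < r" unfolding r_def
    by (metis add_nonneg_nonneg norm_ge_zero order_le_less)
  define z where "z = (norm X + norm Y) / r"
  define w where "w = z powr (p - 1)"
  have z: "0 \<le> z" and R: "norm X + norm Y = z * r" using r by (auto simp: z_def)
  have zw: "z powr p = z * w"
    using z p powr_add[of z 1 "p - 1"] by (cases "z = 0") (auto simp: w_def)
  have rp: "r powr (p - 1) = r powr (p - 2) * r"
    using r powr_add[of r "p - 2" 1] by simp
  have y: "inner y Y = norm y * inner (sgn y) Y" for Y
    by (cases "y = 0") (simp_all add: sgn_div_norm)
  have y': "inner (sgn y) y = norm y"
    by (cases "y = 0") (simp_all add: sgn_div_norm power2_norm_eq_inner[symmetric] power2_eq_square)
  \<comment> \<open>Squaring the domination hypothesis links the two inner products; this becomes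
    hypothesis \<open>c\<close> of \<open>zigzag_scalar\<close>.\<close>
  have "(norm (Y - y))\<^sup>2 \<le> (norm (X - x))\<^sup>2"
    using dom by (intro power_mono) auto
  then have c: "(norm Y)\<^sup>2 - 2 * (norm y * inner (sgn y) Y) + (norm y)\<^sup>2
      \<le> (norm X)\<^sup>2 - 2 * inner x X + (norm x)\<^sup>2"
    using y[of Y] by (simp add: power2_norm_eq_inner inner_diff inner_commute)
  have "norm (sgn y) * norm Y \<le> norm Y"
    by (simp add: norm_sgn)
  then have D: "inner (sgn y) Y \<le> norm Y"
    using norm_cauchy_schwarz order_trans by blast
  have "norm Y - norm y \<le> norm X + norm x"
    using dom norm_triangle_ineq2[of Y y] norm_triangle_ineq4[of X x] by linarith
  then have A: "z * r - r \<le> 2 * norm X" using R by (simp add: r_def)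
  have "(z * r - p * norm X) * (w * r) \<le> (r - p * norm x) * r - p * (p - 1) * (inner x X - (norm x)\<^sup>2)
          + p * (r - (p - 1) * norm x) * (inner (sgn y) Y - (r - norm x))"
  proof (rule zigzag_scalar)
    show "1 + (p - 1) * (z - 1) \<le> w"
      using p z unfolding w_def by (intro powr_ge_tangent) auto
    show "z * w \<le> (p - 1) * (p - 2) / 2 - p * (p - 2) * z + p * (p - 1) / 2 * z\<^sup>2" if "z \<le> 1"
      using powr_le_quadratic[OF z that p] zw by simp
    show "p * w + (p - 2) \<le> (p - 2) * (z * w) + p * z" if "1 \<le> z"
      using powr_ge_quotient[OF that p] zw by (simp add: w_def)
    have "z * r - norm X = norm Y" "r - norm x = norm y"
      using R by (auto simp: r_def)
    then show "inner (sgn y) Y \<le> z * r - norm X"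
      "(z * r - norm X)\<^sup>2 - (norm X)\<^sup>2 - 2 * (r - norm x) * inner (sgn y) Y
        + (r - norm x)\<^sup>2 - (norm x)\<^sup>2 \<le> - 2 * inner x X"
      using D c by auto
  qed (use p z r A in auto)
  \<comment> \<open>The scalar inequality has degree 2 in the lengths; this factor restores the
    degree \<open>p\<close>.\<close>
  from mult_left_mono[OF this, of "r powr (p - 2)"]
  have "r powr (p - 2) * ((z * r - p * norm X) * (w * r)) \<le> r powr (p - 2) *
      ((r - p * norm x) * r - p * (p - 1) * (inner x X - (norm x)\<^sup>2)
          + p * (r - (p - 1) * norm x) * (inner (sgn y) Y - (r - norm x)))" by simp
  moreover have "burkholder p X Y = r powr (p - 2) * ((z * r - p * norm X) * (w * r))"
  proof -
    have "norm Y - (p - 1) * norm X = z * r - p * norm X"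
      using R by (simp add: algebra_simps)
    then show ?thesis
      using z r by (simp add: burkholder_def R powr_mult rp flip: w_def)
  qed
  moreover have "burkholder p x y = r powr (p - 2) * ((r - p * norm x) * r)"
    by (simp add: burkholder_def rp flip: r_def) (simp add: r_def algebra_simps)
  moreover have "inner (sgn y) (Y - y) = inner (sgn y) Y - (r - norm x)"
    by (simp add: inner_diff_right y' r_def)
  moreover have "inner x (X - x) = inner x X - (norm x)\<^sup>2"
    by (simp add: inner_diff_right power2_norm_eq_inner)
  ultimately show ?thesis
    by (simp add: algebra_simps)
qed

section \<open>The Bellman function\<close>

lemma one_minus_powr_tangent:
  fixes z p u :: real
  assumes p: "2 \<le> p" and z: "0 \<le> z" and u: "0 \<le> u" "(p - 1) * u \<le> p"
  shows "1 - u + (p - (p - 1) * u) * (z - 1) \<le> z powr p - u * z powr (p - 1)"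
proof -
  \<comment> \<open>Both sides are affine in \<open>u\<close>. The end values \<open>u = 0\<close>
    and \<open>u = p / (p - 1)\<close> are \<open>powr_ge_tangent\<close> and
    \<open>powr_diff_one_le\<close>; \<open>t\<close> is the weight interpolating between
    them.\<close>
  define t where "t = (p - 1) * u / p"
  have t: "0 \<le> t" "t \<le> 1" and u_eq: "u = t * p / (p - 1)"
    using p u by (auto simp: t_def)
  have "0 \<le> (1 - t) * (z powr p - 1 - p * (z - 1))
      + t * (((p - 1) * z powr p + 1 - p * z powr (p - 1)) / (p - 1))"
    using t p powr_ge_tangent[OF z, of p] powr_diff_one_le[OF z, of p]
    by (intro add_nonneg_nonneg mult_nonneg_nonneg divide_nonneg_nonneg) auto
  also have "\<dots> = z powr p - u * z powr (p - 1) - (1 - u + (p - (p - 1) * u) * (z - 1))"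
    using p unfolding u_eq by (simp add: divide_simps) (simp add: algebra_simps)
  finally show ?thesis by simp
qed

text \<open>Weighted AM-GM for \<open>p\<close> and 1 with weights \<open>(p - 2) / (p - 1)\<close>
  and \<open>1 / (p - 1)\<close>, whose arithmetic mean is \<open>p - 1\<close>. It serves as the
  end value at \<open>w = p\<close> in \<open>conjugate_powr_ge_quadratic\<close>.\<close>

lemma conjugate_powr_le:
  fixes p q :: real
  assumes p: "2 \<le> p" and q: "q = p / (p - 1)"
  shows "q powr (p - 1) \<le> p"
proof -
  have "p powr ((p - 2) / (p - 1)) * 1 powr (1 / (p - 1)) \<le> (p - 2) / (p - 1) * p + 1 / (p - 1) * 1"
    using p by (intro Youngs_inequality_0) (auto simp: divide_simps)
  also have "\<dots> = p - 1"
    using p by (simp add: field_simps)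
  finally have "(p powr ((p - 2) / (p - 1))) powr (p - 1) \<le> (p - 1) powr (p - 1)"
    using p by (intro powr_mono2) auto
  then have "p powr (p - 2) \<le> (p - 1) powr (p - 1)"
    using p by (simp add: powr_powr)
  moreover have "p powr (p - 1) = p powr (p - 2) * p"
    using p powr_add[of p "p - 2" 1] by simp
  ultimately show ?thesis
    using p by (simp add: q powr_divide divide_le_eq mult.commute)
qed

text \<open>The function \<open>?K\<close> is smallest at 1. The coefficient
  \<open>(q - 1)\<^sup>2\<close> is at most the second derivative \<open>q - 1\<close> of
  \<open>w powr q / q\<close> at 1, and is chosen so that for \<open>w = p - (p - 1) * u\<close> the
  quadratic term becomes \<open>(1 - u)\<^sup>2 / 2\<close>.\<close>

lemma conjugate_powr_ge_quadratic:
  fixes p q w :: real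
  assumes p: "2 \<le> p" and q: "q = p / (p - 1)" and w: "0 \<le> w" "w \<le> p"
  shows "1 / q + (w - 1) + (q - 1)\<^sup>2 * (w - 1)\<^sup>2 / 2 \<le> w powr q / q"
proof -
  let ?K = "\<lambda>w. w powr q / q - (w - 1) - (q - 1)\<^sup>2 * (w - 1)\<^sup>2 / 2"
  have q1: "1 < q" "q \<le> 2" "(q - 1) * (p - 1) = 1" and pq: "p - 1 = 1 / (q - 1)"
    using p by (auto simp: q field_simps)
  have K: "(?K has_real_derivative (x powr (q - 1) - 1 - (q - 1)\<^sup>2 * (x - 1))) (at x)" if "0 < x" for x
    using that q1 by (auto intro!: derivative_eq_intros)
  have cont: "continuous_on {a..b} ?K" if "0 \<le> a" for a b
    using that q1 by (intro continuous_intros continuous_on_powr') auto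
  have "?K 1 \<le> ?K w"
  proof (cases "w \<le> 1")
    case True
    then show ?thesis
    proof (rule DERIV_nonpos_imp_decreasing_open)
      fix x assume x: "w < x" "x < 1"
      have "1 + (p - 1) * (x powr (q - 1) - 1) \<le> (x powr (q - 1)) powr (p - 1)"
        using p by (intro powr_ge_tangent) auto
      also have "\<dots> = x" using x w q1 by (simp add: powr_powr)
      finally have "(q - 1) * ((p - 1) * (x powr (q - 1) - 1)) \<le> (q - 1) * (x - 1)"
        using q1 by (intro mult_left_mono) auto
      then have "x powr (q - 1) - 1 \<le> (q - 1) * (x - 1)"
        using q1 by (simp flip: mult.assoc)
      also have "(q - 1) * ((q - 1) * (1 - x)) \<le> 1 * ((q - 1) * (1 - x))"
        using q1 x by (intro mult_right_mono) auto
      then have "(q - 1) * (x - 1) \<le> (q - 1)\<^sup>2 * (x - 1)"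
        by (simp add: power2_eq_square algebra_simps)
      finally show "\<exists>y. (?K has_real_derivative y) (at x) \<and> y \<le> 0"
        using K[of x] x w by fastforce
    qed (use cont w in auto)
  next
    case False
    then have "1 \<le> w" by simp
    then show ?thesis
    proof (rule DERIV_nonneg_imp_increasing_open)
      fix x assume x: "1 < x" "x < w"
      \<comment> \<open>As \<open>x\<close> runs over \<open>{1..p}\<close>, \<open>t\<close> runs
        over \<open>{0..1}\<close>. After raising to the power \<open>p - 1\<close>, the sign of the
        derivative follows from convexity of that power between 1 and \<open>q\<close>.\<close>
      define t where "t = (q - 1) * (x - 1)"
      have t: "0 \<le> t" "t \<le> 1"
      proof -
        show "0 \<le> t" using x q1 by (simp add: t_def)
        have "t \<le> (q - 1) * (p - 1)"
          unfolding t_def using x w q1 by (intro mult_left_mono) auto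
        then show "t \<le> 1" using q1 by simp
      qed
      have "((1 - t) *\<^sub>R 1 + t *\<^sub>R q) powr (p - 1) \<le> (1 - t) * 1 powr (p - 1) + t * q powr (p - 1)"
        using p q1 t by (intro convex_onD[OF powr_convex]) auto
      also have "\<dots> \<le> (1 - t) + t * p"
        using t conjugate_powr_le[OF p q] by (auto intro: mult_left_mono)
      also have "\<dots> = 1 + (q - 1) * (p - 1) * (x - 1)"
        by (simp add: t_def algebra_simps)
      also have "\<dots> = x" using q1 by simp
      finally have "(1 + t * (q - 1)) powr (p - 1) \<le> x" by (simp add: algebra_simps)
      then have "((1 + t * (q - 1)) powr (p - 1)) powr (q - 1) \<le> x powr (q - 1)"
        using q1 by (intro powr_mono2) auto
      moreover have "((1 + t * (q - 1)) powr (p - 1)) powr (q - 1) = 1 + t * (q - 1)"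
        using q1 t by (simp add: powr_powr mult.commute[of "p - 1"] add_nonneg_nonneg)
      ultimately have "0 \<le> x powr (q - 1) - 1 - (q - 1)\<^sup>2 * (x - 1)"
        by (simp add: t_def power2_eq_square algebra_simps)
      then show "\<exists>y. (?K has_real_derivative y) (at x) \<and> 0 \<le> y"
        using K[of x] x by fastforce
    qed (use cont in auto)
  qed
  then show ?thesis by simp
qed

text \<open>In \<open>burkholder_maximiser\<close>, \<open>u = norm x / \<rho>\<close> and
  \<open>w = norm g / \<rho> powr (p - 1)\<close>, so this is the size bound divided by
  \<open>\<rho> powr p\<close>. The left-hand side equals
  \<open>(p - 1) * (p - p * u + u\<^sup>2)\<close>, and this quadratic in \<open>u\<close> is the
  sum of quadratic minorants of the two powers.\<close>

lemma stationary_value_le: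
  fixes p q u w :: real
  assumes p: "2 \<le> p" and q: "q = p / (p - 1)" and u: "0 \<le> u" and w: "w = p - (p - 1) * u" "0 \<le> w"
  shows "(p - u) * w - p * (1 - u) \<le> (p - 1) * (u powr p / p + w powr q / q)"
proof -
  have wp: "w \<le> p" using p u w by simp
  have "(q - 1) * (w - 1) = 1 - u"
    using p by (simp add: q w field_simps)
  then have "(q - 1)\<^sup>2 * (w - 1)\<^sup>2 = (1 - u)\<^sup>2"
    by (simp flip: power_mult_distrib)
  with conjugate_powr_ge_quadratic[OF p q w(2) wp]
  have "1 / q + (w - 1) + (1 - u)\<^sup>2 / 2 \<le> w powr q / q" by simp
  moreover have "1 / p + (u\<^sup>2 - 1) / 2 \<le> u powr p / p"
  proof -
    have "1 + p / 2 * (u\<^sup>2 - 1) \<le> (u\<^sup>2) powr (p / 2)"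
      using p by (intro powr_ge_tangent) auto
    also have "(u\<^sup>2) powr (p / 2) = u powr p"
      using u p by (cases "u = 0") (auto simp: powr_powr simp flip: powr_numeral)
    finally have "(1 + p / 2 * (u\<^sup>2 - 1)) / p \<le> u powr p / p"
      using p by (intro divide_right_mono) auto
    then show ?thesis using p by (simp add: add_divide_distrib)
  qed
  moreover have "1 / p + 1 / q = 1" using p by (simp add: q field_simps)
  ultimately have "p - p * u + u\<^sup>2 \<le> u powr p / p + w powr q / q"
    by (simp add: w(1) algebra_simps power2_eq_square add_divide_distrib diff_divide_distrib)
  then have "(p - 1) * (p - p * u + u\<^sup>2) \<le> (p - 1) * (u powr p / p + w powr q / q)"
    using p by (intro mult_left_mono) auto
  then show ?thesis by (simp add: w(1) algebra_simps power2_eq_square)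
qed

text \<open>With \<open>a = norm x\<close>, \<open>c = norm g\<close> and
  \<open>norm x + norm y = p * \<rho>\<close>, this is the critical point equation of the Legendre
  transform: the slope of the normalised Burkholder function in \<open>norm y\<close> equals
  \<open>c\<close>.\<close>

lemma stationary_point_exists:
  fixes p a c :: real
  assumes p: "2 \<le> p" and a: "0 \<le> a" and c: "0 \<le> c"
  obtains \<rho> where "0 \<le> \<rho>" "(p - 1) * a \<le> p * \<rho>" "\<rho> powr (p - 2) * (p * \<rho> - (p - 1) * a) = c"
proof (cases "a = 0")
  case True
  let ?\<rho> = "(c / p) powr (1 / (p - 1))"
  have "?\<rho> powr (p - 2) * ?\<rho> = c / p"
    using p c by (cases "c = 0") (auto simp: powr_powr field_simps simp flip: powr_add add_divide_distrib)
  then have "?\<rho> powr (p - 2) * (p * ?\<rho> - (p - 1) * a) = c"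
    using True p by (simp add: mult_ac)
  then show ?thesis using that[of ?\<rho>] True p by simp
next
  case False
  \<comment> \<open>The slope vanishes at \<open>l\<close> and is at least \<open>c\<close> at
    \<open>h\<close>.\<close>
  define l where "l = (p - 1) * a / p"
  define h where "h = max a (c powr (1 / (p - 1)))"
  let ?F = "\<lambda>\<rho>. \<rho> powr (p - 2) * (p * \<rho> - (p - 1) * a)"
  have l: "0 < l" "l \<le> a" using False a p by (auto simp: l_def field_simps)
  have h: "a \<le> h" "c powr (1 / (p - 1)) \<le> h" by (auto simp: h_def)
  have "c = (c powr (1 / (p - 1))) powr (p - 1)" using c p by (simp add: powr_powr)
  also have "\<dots> \<le> h powr (p - 1)" using h p by (intro powr_mono2) auto
  also have "\<dots> = h powr (p - 2) * h"
    using h a p powr_add[of h "p - 2" 1] False by simp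
  also have "\<dots> \<le> ?F h"
  proof (rule mult_left_mono)
    have "(p - 1) * a \<le> (p - 1) * h" using h p by (intro mult_left_mono) auto
    then show "h \<le> p * h - (p - 1) * a" by (simp add: algebra_simps)
  qed simp
  finally have "c \<le> ?F h" .
  moreover have "?F l \<le> c" using c p by (simp add: l_def)
  moreover have "continuous_on {l..h} ?F"
    using l by (intro continuous_intros) auto
  ultimately obtain \<rho> where "l \<le> \<rho>" "\<rho> \<le> h" "?F \<rho> = c"
    using IVT'[of ?F l c h] l h by auto
  moreover from this have "p * l \<le> p * \<rho>" using p by (intro mult_left_mono) auto
  ultimately show ?thesis
    using l p by (intro that[of \<rho>]) (auto simp: l_def)
qed

lemma burkholder_scaled:
  fixes x y :: "'a::real_normed_vector"
  assumes p: "2 \<le> p" and \<rho>: "norm x + norm y = p * \<rho>"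
  shows "p powr (1 - p) * burkholder p x y = p * (\<rho> powr p - norm x * \<rho> powr (p - 1))"
proof -
  have "norm y - (p - 1) * norm x = p * (\<rho> - norm x)"
    using \<rho> by (simp add: algebra_simps)
  moreover have "0 \<le> \<rho>"
    using \<rho> p by (metis add_nonneg_nonneg norm_ge_zero not_less zero_less_numeral order_less_le_trans mult_pos_neg)
  moreover from this have "\<rho> powr p = \<rho> powr (p - 1) * \<rho>"
    using p powr_add[of \<rho> "p - 1" 1] by (cases "\<rho> = 0") auto
  moreover have "p powr (1 - p) * p powr (p - 1) = 1"
    using p by (simp flip: powr_add)
  ultimately show ?thesis
    using p by (simp add: burkholder_def \<rho> powr_mult algebra_simps)
qed

text \<open>For fixed \<open>norm x = a\<close> the scaled Burkholder function lies above its
  tangent at \<open>\<rho>\<close>, although it need not be convex: division by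
  \<open>\<rho> powr p\<close> leads to \<open>one_minus_powr_tangent\<close>. Hence the stationary
  point is a global maximiser.\<close>

lemma stationary_point_maximal:
  fixes p a t \<rho> :: real
  assumes p: "2 \<le> p" and a: "0 \<le> a" and t: "0 \<le> t" and \<rho>: "0 \<le> \<rho>" "(p - 1) * a \<le> p * \<rho>"
  shows "p * (\<rho> powr p - a * \<rho> powr (p - 1)) + \<rho> powr (p - 2) * (p * \<rho> - (p - 1) * a) * (p * t - p * \<rho>)
    \<le> p * (t powr p - a * t powr (p - 1))"
proof (cases "\<rho> = 0")
  case True
  then have "(p - 1) * a \<le> 0" using \<rho> by simp
  then have "a = 0" using a p by (simp add: mult_le_0_iff)
  then show ?thesis using True p by simp
next
  case False
  then have \<rho>0: "0 < \<rho>" using \<rho> by simp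
  have pw: "\<rho> powr p = \<rho> powr (p - 2) * \<rho>\<^sup>2" "\<rho> powr (p - 1) = \<rho> powr (p - 2) * \<rho>"
    using \<rho>0 powr_add[of \<rho> "p - 2" 2] powr_add[of \<rho> "p - 2" 1] by (auto simp: powr_numeral)
  define z where "z = t / \<rho>"
  define u where "u = a / \<rho>"
  have zu: "t = z * \<rho>" "a = u * \<rho>" "0 \<le> z" "0 \<le> u" using \<rho>0 t a by (auto simp: z_def u_def)
  have "(p - 1) * u \<le> p" using \<rho>(2) \<rho>0 by (simp add: u_def field_simps)
  from one_minus_powr_tangent[OF p zu(3,4) this]
  have "p * \<rho> powr (p - 2) * \<rho>\<^sup>2 * (1 - u + (p - (p - 1) * u) * (z - 1))
      \<le> p * \<rho> powr (p - 2) * \<rho>\<^sup>2 * (z powr p - u * z powr (p - 1))"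
    using p by (intro mult_left_mono) auto
  moreover have "t powr p = z powr p * (\<rho> powr (p - 2) * \<rho>\<^sup>2)"
      "t powr (p - 1) = z powr (p - 1) * (\<rho> powr (p - 2) * \<rho>)"
    using zu \<rho>0 by (auto simp: powr_mult pw)
  ultimately show ?thesis
    unfolding pw by (simp add: zu(2)) (simp add: zu(1) algebra_simps power2_eq_square)
qed

text \<open>The Legendre transform of \<open>p powr (1 - p) * burkholder p\<close> in its second variable, with an
  explicit maximiser.\<close>
lemma burkholder_maximiser:
  fixes x g :: "'a::euclidean_space"
  assumes p: "2 \<le> p" and q: "q = p / (p - 1)"
  defines "W \<equiv> \<lambda>x y. p powr (1 - p) * burkholder p x y"
  obtains y \<alpha> where "\<And>y'. inner y' g - W x y' \<le> inner y g - W x y"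
    and "inner y g - W x y \<le> (p - 1) * (norm x powr p / p + norm g powr q / q)"
    and "\<And>X Y. norm (Y - y) \<le> norm (X - x) \<Longrightarrow>
      W X Y \<le> W x y - inner \<alpha> (X - x) + inner g (Y - y)"
proof -
  obtain e :: 'a where e: "norm e = 1" "g = norm g *\<^sub>R e"
  proof (cases "g = 0")
    case True
    then show ?thesis using that[of "SOME b. b \<in> Basis"] norm_Basis SOME_Basis by auto
  next
    case False
    then show ?thesis using that[of "sgn g"] by (simp add: norm_sgn) (simp add: sgn_div_norm)
  qed
  obtain \<rho> where \<rho>: "0 \<le> \<rho>" "(p - 1) * norm x \<le> p * \<rho>"
    and c: "\<rho> powr (p - 2) * (p * \<rho> - (p - 1) * norm x) = norm g"
    using stationary_point_exists[OF p norm_ge_zero norm_ge_zero] by metis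
  \<comment> \<open>The norm of the maximiser, so that
    \<open>norm x + norm y = p * \<rho>\<close>.\<close>
  define s where "s = p * \<rho> - norm x"
  have "1 * norm x \<le> (p - 1) * norm x" using p by (intro mult_right_mono) auto
  then have s: "0 \<le> s" using \<rho>(2) by (simp add: s_def)
  define y where "y = s *\<^sub>R e"
  have ny: "norm y = s" using s e by (simp add: y_def)
  have W: "W x y = p * (\<rho> powr p - norm x * \<rho> powr (p - 1))"
    unfolding W_def by (rule burkholder_scaled[OF p]) (simp add: ny s_def)
  have yg: "inner y g = s * norm g"
    by (subst e(2)) (simp add: y_def e(1) power2_norm_eq_inner[symmetric] flip: power2_norm_eq_inner)
  have max: "inner y' g - W x y' \<le> inner y g - W x y" for y'
  proof -
    define t where "t = (norm x + norm y') / p"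
    have t: "0 \<le> t" "norm x + norm y' = p * t" using p by (auto simp: t_def)
    have "W x y' = p * (t powr p - norm x * t powr (p - 1))"
      unfolding W_def by (rule burkholder_scaled[OF p t(2)])
    moreover have "inner y' g \<le> norm y' * norm g" by (rule norm_cauchy_schwarz)
    moreover have "p * t - p * \<rho> = norm y' - s" using t by (simp add: s_def)
    with stationary_point_maximal[OF p norm_ge_zero[of x] t(1) \<rho>]
    have "W x y + norm g * (norm y' - s) \<le> p * (t powr p - norm x * t powr (p - 1))"
      by (simp only: c W)
    ultimately show ?thesis
      by (simp add: yg algebra_simps)
  qed
  have "inner y g - W x y \<le> (p - 1) * (norm x powr p / p + norm g powr q / q)"
  proof (cases "\<rho> = 0")
    case True
    then have "norm g = 0" using c by simp
    then show ?thesis using True W yg p q by simp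
  next
    case False
    then have \<rho>0: "0 < \<rho>" using \<rho> by simp
    define u where "u = norm x / \<rho>"
    define w where "w = p - (p - 1) * u"
    have u: "0 \<le> u" "norm x = u * \<rho>" using \<rho>0 by (auto simp: u_def)
    have w: "0 \<le> w" using \<rho>(2) \<rho>0 by (simp add: w_def u_def field_simps)
    have pw: "\<rho> powr p = \<rho> powr (p - 2) * \<rho>\<^sup>2" "\<rho> powr (p - 1) = \<rho> powr (p - 2) * \<rho>"
      using \<rho>0 powr_add[of \<rho> "p - 2" 2] powr_add[of \<rho> "p - 2" 1] by (auto simp: powr_numeral)
    have g: "norm g = \<rho> powr (p - 1) * w"
      unfolding pw using c u by (simp add: w_def algebra_simps)
    have "(p - 1) * q = p" using p q by simp
    then have gq: "norm g powr q = \<rho> powr p * w powr q"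
      using \<rho>0 w by (simp add: g powr_mult powr_powr)
    have xp: "norm x powr p = \<rho> powr p * u powr p"
      using u \<rho>0 by (simp add: powr_mult)
    have "inner y g - W x y = \<rho> powr p * ((p - u) * w - p * (1 - u))"
      unfolding yg W g s_def u(2) pw by (simp add: algebra_simps power2_eq_square)
    also have "\<dots> \<le> \<rho> powr p * ((p - 1) * (u powr p / p + w powr q / q))"
      by (intro mult_left_mono stationary_value_le p q u w_def w) auto
    also have "\<dots> = (p - 1) * (norm x powr p / p + norm g powr q / q)"
      unfolding gq xp by (simp add: algebra_simps)
    finally show ?thesis .
  qed
  moreover
  define r where "r = norm x + norm y"
  define \<alpha> where "\<alpha> = (p powr (1 - p) * (p * (p - 1) * r powr (p - 2))) *\<^sub>R x"
  have r: "r = p * \<rho>" by (simp add: r_def ny s_def)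
  \<comment> \<open>By the choice of \<open>\<rho>\<close>, the normalised slope in \<open>y\<close>
    from \<open>burkholder_zigzag\<close> is exactly \<open>norm g\<close>.\<close>
  have slope: "p powr (1 - p) * (p * r powr (p - 2) * (r - (p - 1) * norm x)) = norm g"
  proof -
    have "p powr (1 - p) * (p * p powr (p - 2)) = 1"
    proof -
      have "p * p powr (p - 2) = p powr (p - 1)"
        using p powr_add[of p 1 "p - 2"] by simp
      then show ?thesis using p by (simp flip: powr_add)
    qed
    then show ?thesis
      using p \<rho> by (simp add: r powr_mult flip: c)
  qed
  \<comment> \<open>If \<open>s = 0\<close> then \<open>sgn y = 0\<close>, and \<open>g = 0\<close>
    is required; the equation for \<open>\<rho>\<close> then makes \<open>norm g\<close>
    nonpositive.\<close>
  have sgn: "norm g *\<^sub>R sgn y = g"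
  proof (cases "s = 0")
    case True
    have "norm g = \<rho> powr (p - 2) * ((2 - p) * norm x)"
      using True by (simp add: s_def flip: c) (simp add: algebra_simps)
    also have "\<dots> \<le> 0" using p by (intro mult_nonneg_nonpos mult_nonpos_nonneg) auto
    finally show ?thesis by simp
  next
    case False
    then have "sgn y = e" using s e by (simp add: y_def sgn_div_norm)
    then show ?thesis using e(2) by simp
  qed
  have "W X Y \<le> W x y - inner \<alpha> (X - x) + inner g (Y - y)" if "norm (Y - y) \<le> norm (X - x)" for X Y
  proof -
    have "W X Y \<le> p powr (1 - p) * (burkholder p x y
        - p * (p - 1) * r powr (p - 2) * inner x (X - x)
        + p * r powr (p - 2) * (r - (p - 1) * norm x) * inner (sgn y) (Y - y))"
      unfolding W_def r_def by (intro mult_left_mono burkholder_zigzag[OF p that]) auto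
    also have "\<dots> = W x y - inner \<alpha> (X - x) + norm g * inner (sgn y) (Y - y)"
      unfolding slope[symmetric] by (simp add: W_def \<alpha>_def algebra_simps)
    also have "norm g * inner (sgn y) (Y - y) = inner g (Y - y)"
      by (metis inner_scaleR_left sgn)
    finally show ?thesis .
  qed
  ultimately show ?thesis using that max by blast
qed

lemma bellman_function_exists:
  fixes p q :: real
  assumes p: "2 \<le> p" and q: "q = p / (p - 1)"
  obtains b :: "'a::euclidean_space \<Rightarrow> 'a \<Rightarrow> real"
  where "\<And>x g. 0 \<le> b x g"
    and "\<And>x g. b x g \<le> (p - 1) * (norm x powr p / p + norm g powr q / q)"
    and "\<And>x g. \<exists>\<alpha> \<beta>. \<forall>x' g'.
      b x g + inner \<alpha> (x' - x) + inner \<beta> (g' - g) + norm (x' - x) * norm (g' - g) \<le> b x' g'"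
proof -
  define W where "W = (\<lambda>(x::'a) (y::'a). p powr (1 - p) * burkholder p x y)"
  define P where "P x g y \<longleftrightarrow> (\<forall>y'. inner y' g - W x y' \<le> inner y g - W x y) \<and>
      inner y g - W x y \<le> (p - 1) * (norm x powr p / p + norm g powr q / q) \<and>
      (\<exists>\<alpha>. \<forall>X Y. norm (Y - y) \<le> norm (X - x) \<longrightarrow>
        W X Y \<le> W x y - inner \<alpha> (X - x) + inner g (Y - y))" for x g y
  define m where "m x g = (SOME y. P x g y)" for x g
  have "\<exists>y. P x g y" for x g
    using burkholder_maximiser[OF p q, of g x] unfolding W_def P_def by metis
  then have m: "P x g (m x g)" for x g
    unfolding m_def by (rule someI_ex)
  then have max: "inner y' g - W x y' \<le> inner (m x g) g - W x (m x g)"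
    and le: "inner (m x g) g - W x (m x g) \<le> (p - 1) * (norm x powr p / p + norm g powr q / q)"
    and zz: "\<exists>\<alpha>. \<forall>X Y. norm (Y - m x g) \<le> norm (X - x) \<longrightarrow>
        W X Y \<le> W x (m x g) - inner \<alpha> (X - x) + inner g (Y - m x g)" for x g y'
    unfolding P_def by blast+
  show ?thesis
  proof (rule that)
    fix x g
    show "inner (m x g) g - W x (m x g) \<le> (p - 1) * (norm x powr p / p + norm g powr q / q)"
      by (rule le)
    have "W x 0 \<le> 0"
      using p by (simp add: W_def burkholder_def mult_nonneg_nonpos mult_nonpos_nonneg)
    then show "0 \<le> inner (m x g) g - W x (m x g)"
      using max[of 0 g x] by simp
    obtain \<alpha> where \<alpha>: "\<And>X Y. norm (Y - m x g) \<le> norm (X - x) \<Longrightarrow>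
        W X Y \<le> W x (m x g) - inner \<alpha> (X - x) + inner g (Y - m x g)"
      using zz by metis
    \<comment> \<open>The supporting slope in \<open>g\<close> is the maximiser itself; the slope in
      \<open>x\<close> comes from the tangent plane of \<open>W\<close>.\<close>
    have "inner (m x g) g - W x (m x g) + inner \<alpha> (x' - x) + inner (m x g) (g' - g)
        + norm (x' - x) * norm (g' - g) \<le> inner (m x' g') g' - W x' (m x' g')" for x' g'
    proof -
      \<comment> \<open>For \<open>g' = g\<close> this is 0, which is admissible because only
        \<open>norm k \<le> norm (x' - x)\<close> is asked for.\<close>
      define k where "k = norm (x' - x) *\<^sub>R sgn (g' - g)"
      have "norm k \<le> norm (x' - x)" by (simp add: k_def norm_sgn)
      with \<alpha>[of "m x g + k" x'] have "W x' (m x g + k) \<le> W x (m x g) - inner \<alpha> (x' - x) + inner g k"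
        by simp
      moreover have "inner k (g' - g) = norm (x' - x) * norm (g' - g)"
        by (cases "g' = g")
          (simp_all add: k_def sgn_div_norm power2_norm_eq_inner[symmetric] power2_eq_square)
      ultimately show ?thesis
        using max[of "m x g + k" g' x'] by (simp add: algebra_simps inner_commute)
    qed
    then show "\<exists>\<alpha> \<beta>. \<forall>x' g'. inner (m x g) g - W x (m x g) + inner \<alpha> (x' - x)
        + inner \<beta> (g' - g) + norm (x' - x) * norm (g' - g) \<le> inner (m x' g') g' - W x' (m x' g')"
      by blast
  qed
qed

section \<open>The heat flow on the lattice\<close>

locale lattice_heat =
  fixes N :: nat and G :: "int monoid"
  assumes group_G: "group G" and one_closed: "1 \<in> carrier G"
begin

sublocale H: group "gpow N G"
  by (rule group_gpow[OF group_G])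

abbreviation "V \<equiv> carrier (gpow N G)"
abbreviation "lap \<equiv> laplacian N G"
abbreviation "heat \<equiv> heat_ext N G"
abbreviation "test \<equiv> test_function N G"

section \<open>Translations and absolute summability\<close>

definition fw :: "nat \<Rightarrow> (nat \<Rightarrow> int) \<Rightarrow> nat \<Rightarrow> int"
  where "fw i n = n \<otimes>\<^bsub>gpow N G\<^esub> unit_vec N G i"

definition bw :: "nat \<Rightarrow> (nat \<Rightarrow> int) \<Rightarrow> nat \<Rightarrow> int"
  where "bw i n = n \<otimes>\<^bsub>gpow N G\<^esub> (inv\<^bsub>gpow N G\<^esub> unit_vec N G i)"

lemma e_closed: "unit_vec N G i \<in> V"
  by (rule unit_vec_closed[OF group_G one_closed])

lemma fw_closed [simp]: "n \<in> V \<Longrightarrow> fw i n \<in> V"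
  and bw_closed [simp]: "n \<in> V \<Longrightarrow> bw i n \<in> V"
  by (simp_all add: fw_def bw_def e_closed)

lemma fw_bw [simp]: "n \<in> V \<Longrightarrow> fw i (bw i n) = n"
  and bw_fw [simp]: "n \<in> V \<Longrightarrow> bw i (fw i n) = n"
  by (simp_all add: fw_def bw_def e_closed H.m_assoc)

lemma bij_fw: "bij_betw (fw i) V V"
  by (rule bij_betwI[of _ _ _ "bw i"]) auto

lemma bij_bw: "bij_betw (bw i) V V"
  by (rule bij_betwI[of _ _ _ "fw i"]) auto

lemma lap_eq: "n \<in> V \<Longrightarrow> lap f n = (\<Sum>i=1..N. f (fw i n) - 2 * f n + f (bw i n))"
  unfolding fw_def bw_def by (rule laplacian_eq[OF group_G one_closed])

lemma fwd_diff_eq: "fwd_diff N G i f n = f (fw i n) - f n"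
  by (simp add: fwd_diff_def fw_def)

lemma test_imp_summable:
  assumes "test f"
  shows "(\<lambda>n. norm (f n)) summable_on V"
proof -
  have "(\<lambda>n. norm (f n)) summable_on {n \<in> V. f n \<noteq> 0}"
    using assms by (intro summable_on_finite) (simp add: test_function_def)
  then show ?thesis
    by (rule summable_on_cong_neutral[THEN iffD1, rotated -1]) auto
qed

lemma test_lap:
  assumes "test f"
  shows "test (lap f)"
proof -
  let ?S = "{n \<in> V. f n \<noteq> 0}"
  have "{n \<in> V. lap f n \<noteq> 0} \<subseteq> ?S \<union> (\<Union>i\<in>{1..N}. bw i ` ?S \<union> fw i ` ?S)"
  proof
    fix n assume n: "n \<in> {n \<in> V. lap f n \<noteq> 0}"
    then obtain i where i: "i \<in> {1..N}" "f (fw i n) - 2 * f n + f (bw i n) \<noteq> 0"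
      by (auto simp: lap_eq intro: sum.not_neutral_contains_not_neutral)
    then consider "f n \<noteq> 0" | "f (fw i n) \<noteq> 0" | "f (bw i n) \<noteq> 0" by force
    then show "n \<in> ?S \<union> (\<Union>i\<in>{1..N}. bw i ` ?S \<union> fw i ` ?S)"
    proof cases
      case 2
      then have "n \<in> bw i ` ?S" using n by (intro image_eqI[of _ _ "fw i n"]) auto
      then show ?thesis using i by blast
    next
      case 3
      then have "n \<in> fw i ` ?S" using n by (intro image_eqI[of _ _ "bw i n"]) auto
      then show ?thesis using i by blast
    qed (use n in auto)
  qed
  from finite_subset[OF this] show ?thesis
    using assms by (simp add: test_function_def)
qed

text \<open>Translation invariance of counting measure, by which the differences of the Bellman
  function cancel in lattice sums.\<close>

lemma has_sum_shift:
  fixes h :: "(nat \<Rightarrow> int) \<Rightarrow> real"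
  assumes "(h has_sum s) V"
  shows "((\<lambda>n. h (fw i n)) has_sum s) V" "((\<lambda>n. h (bw i n)) has_sum s) V"
  using assms has_sum_reindex_bij_betw[OF bij_fw] has_sum_reindex_bij_betw[OF bij_bw] by blast+

lemma has_sum_finite_sum:
  fixes h :: "'i \<Rightarrow> 'b \<Rightarrow> real"
  assumes "finite I" "\<And>i. i \<in> I \<Longrightarrow> (h i has_sum s i) A"
  shows "((\<lambda>n. \<Sum>i\<in>I. h i n) has_sum (\<Sum>i\<in>I. s i)) A"
  using assms by (induction I rule: finite_induct) (auto intro: has_sum_add)

text \<open>Each coordinate contributes a centre term of weight 2 and two translates with the same
  sum, hence the factor 4.\<close>

lemma lap_norm_summable:
  assumes "(\<lambda>n. norm (f n)) summable_on V"
  shows "(\<lambda>n. norm (lap f n)) summable_on V"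
    and "infsum (\<lambda>n. norm (lap f n)) V \<le> 4 * real N * infsum (\<lambda>n. norm (f n)) V"
proof -
  let ?s = "infsum (\<lambda>n. norm (f n)) V"
  let ?h = "\<lambda>n. \<Sum>i=1..N. norm (f (fw i n)) + 2 * norm (f n) + norm (f (bw i n))"
  have f: "((\<lambda>n. norm (f n)) has_sum ?s) V" using assms by simp
  have h: "(?h has_sum (\<Sum>i=1..N. ?s + 2 * ?s + ?s)) V"
    by (intro has_sum_finite_sum has_sum_add has_sum_cmult_right has_sum_shift f) auto
  have le: "norm (lap f n) \<le> ?h n" if "n \<in> V" for n
    unfolding lap_eq[OF that]
    by (intro sum_norm_le norm_triangle_le add_mono order.refl norm_triangle_le_diff) (simp add: norm_mult)
  show "(\<lambda>n. norm (lap f n)) summable_on V"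
    using has_sum_imp_summable[OF h] le by (rule summable_on_comparison_test) auto
  then have "infsum (\<lambda>n. norm (lap f n)) V \<le> (\<Sum>i=1..N. ?s + 2 * ?s + ?s)"
    using h le by (intro has_sum_mono[OF has_sum_infsum])
  then show "infsum (\<lambda>n. norm (lap f n)) V \<le> 4 * real N * ?s" by (simp add: algebra_simps)
qed

lemma lap_power_norm_summable:
  assumes "(\<lambda>n. norm (f n)) summable_on V"
  shows "(\<lambda>n. norm ((lap ^^ k) f n)) summable_on V \<and>
    infsum (\<lambda>n. norm ((lap ^^ k) f n)) V \<le> (4 * real N) ^ k * infsum (\<lambda>n. norm (f n)) V"
proof (induction k)
  case 0
  then show ?case using assms by simp
next
  case (Suc k)
  let ?h = "(lap ^^ k) f"
  have "infsum (\<lambda>n. norm (lap ?h n)) V \<le> 4 * real N * infsum (\<lambda>n. norm (?h n)) V"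
    using Suc lap_norm_summable by blast
  also have "\<dots> \<le> 4 * real N * ((4 * real N) ^ k * infsum (\<lambda>n. norm (f n)) V)"
    using Suc by (intro mult_left_mono) auto
  finally show ?case using Suc lap_norm_summable(1)[of ?h] by (simp add: mult_ac)
qed

text \<open>The exponential series with absolute values at the final time. A single function of
  \<open>n\<close> thus dominates the heat extension on all of \<open>{0..T}\<close>, and it is
  summable over the lattice.\<close>

definition major :: "real \<Rightarrow> ((nat \<Rightarrow> int) \<Rightarrow> complex) \<Rightarrow> (nat \<Rightarrow> int) \<Rightarrow> real"
  where "major T f n = (\<Sum>k. T ^ k / fact k * norm ((lap ^^ k) f n))"

lemma summable_major:
  assumes "test f" "n \<in> V" "0 \<le> T"
  shows "summable (\<lambda>k. T ^ k / fact k * norm ((lap ^^ k) f n))"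
proof -
  obtain C where C: "\<And>n. n \<in> V \<Longrightarrow> norm (f n) \<le> C"
    using test_function_bounded[OF assms(1)] by metis
  show ?thesis
  proof (rule summable_comparison_test')
    show "summable (\<lambda>k. C * ((4 * real N * T) ^ k /\<^sub>R fact k))"
      by (intro summable_mult summable_exp_generic)
    fix k
    have "norm ((lap ^^ k) f n) \<le> (4 * real N) ^ k * C"
      using C by (intro norm_laplacian_power_le group_G one_closed assms)
    from mult_left_mono[OF this, of "T ^ k / fact k"]
    show "norm (T ^ k / fact k * norm ((lap ^^ k) f n)) \<le> C * ((4 * real N * T) ^ k /\<^sub>R fact k)"
      using assms(3) by (simp add: power_mult_distrib field_simps)
  qed
qed

lemma major_nonneg: "test f \<Longrightarrow> n \<in> V \<Longrightarrow> 0 \<le> T \<Longrightarrow> 0 \<le> major T f n"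
  unfolding major_def by (intro suminf_nonneg summable_major) auto

lemma major_summable_on:
  assumes f: "test f" and T: "0 \<le> T"
  shows "major T f summable_on V"
proof (rule nonneg_bdd_above_summable_on)
  show "0 \<le> major T f n" if "n \<in> V" for n by (rule major_nonneg[OF f that T])
  let ?s = "infsum (\<lambda>n. norm (f n)) V"
  note L = lap_power_norm_summable[OF test_imp_summable[OF f]]
  \<comment> \<open>The bound is \<open>exp (4 * real N * T)\<close> times \<open>?s\<close>,
    uniformly in the finite set.\<close>
  have "sum (major T f) S \<le> (\<Sum>k. ?s * ((4 * real N * T) ^ k /\<^sub>R fact k))"
    if S: "S \<subseteq> V" "finite S" for S
  proof -
    have "sum (major T f) S = (\<Sum>k. \<Sum>n\<in>S. T ^ k / fact k * norm ((lap ^^ k) f n))"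
      unfolding major_def using S by (intro suminf_sum[symmetric] summable_major f T) auto
    also have "\<dots> \<le> (\<Sum>k. ?s * ((4 * real N * T) ^ k /\<^sub>R fact k))"
    proof (rule suminf_le)
      show "summable (\<lambda>k. \<Sum>n\<in>S. T ^ k / fact k * norm ((lap ^^ k) f n))"
        using S by (intro summable_sum summable_major f T) auto
      show "summable (\<lambda>k. ?s * ((4 * real N * T) ^ k /\<^sub>R fact k))"
        by (intro summable_mult summable_exp_generic)
      fix k
      have "(\<Sum>n\<in>S. norm ((lap ^^ k) f n)) \<le> infsum (\<lambda>n. norm ((lap ^^ k) f n)) V"
        using S L by (intro finite_sum_le_infsum) auto
      also have "\<dots> \<le> (4 * real N) ^ k * ?s" using L by blast
      finally have "T ^ k / fact k * (\<Sum>n\<in>S. norm ((lap ^^ k) f n)) \<le> T ^ k / fact k * ((4 * real N) ^ k * ?s)"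
        using T by (intro mult_left_mono) auto
      then show "(\<Sum>n\<in>S. T ^ k / fact k * norm ((lap ^^ k) f n)) \<le> ?s * ((4 * real N * T) ^ k /\<^sub>R fact k)"
        by (simp add: sum_distrib_left power_mult_distrib field_simps)
    qed
    finally show ?thesis .
  qed
  then show "bdd_above (sum (major T f) ` {F. F \<subseteq> V \<and> finite F})"
    by (intro bdd_aboveI2) auto
qed

section \<open>The heat extension: domination and regularity in time\<close>

lemma heat_sums:
  assumes f: "test f" and n: "n \<in> V"
  shows "(\<lambda>k. (t ^ k / fact k) *\<^sub>R (lap ^^ k) f n) sums heat f t n"
proof -
  have "summable (\<lambda>k. (t ^ k / fact k) *\<^sub>R (lap ^^ k) f n)"
    using summable_heat_ext[OF group_G one_closed f n, of "complex_of_real t"]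
    by (simp add: scaleR_conv_of_real mult_ac)
  then show ?thesis unfolding heat_ext_def by (rule summable_sums)
qed

lemma norm_heat_le:
  assumes f: "test f" and n: "n \<in> V" and t: "0 \<le> t" "t \<le> T"
  shows "norm (heat f t n) \<le> major T f n"
  unfolding heat_ext_def major_def
proof (rule norm_suminf_le)
  show "summable (\<lambda>k. T ^ k / fact k * norm ((lap ^^ k) f n))"
    using t by (intro summable_major f n) auto
  show "norm ((t ^ k / fact k) *\<^sub>R (lap ^^ k) f n) \<le> T ^ k / fact k * norm ((lap ^^ k) f n)" for k
    using t by (simp add: mult_right_mono divide_right_mono power_mono)
qed

text \<open>The time derivative is thereby the heat extension of the test function
  \<open>lap f\<close>, so \<open>major\<close> dominates time derivatives too.\<close>

lemma heat_lap:
  assumes f: "test f" and n: "n \<in> V"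
  shows "heat (lap f) t n = lap (heat f t) n"
proof -
  let ?a = "\<lambda>k m. (t ^ k / fact k) *\<^sub>R (lap ^^ k) f m"
  have "(\<lambda>k. \<Sum>i=1..N. ?a k (fw i n) - 2 * ?a k n + ?a k (bw i n)) sums lap (heat f t) n"
    unfolding lap_eq[OF n] using n
    by (intro sums_sum sums_add sums_diff sums_mult heat_sums f) auto
  moreover have "(t ^ k / fact k) *\<^sub>R (lap ^^ k) (lap f) n = (\<Sum>i=1..N. ?a k (fw i n) - 2 * ?a k n + ?a k (bw i n))" for k
  proof -
    have "(lap ^^ k) (lap f) n = lap ((lap ^^ k) f) n" by (simp flip: funpow_swap1)
    then show ?thesis
      by (simp add: lap_eq[OF n] scaleR_sum_right scaleR_right_diff_distrib scaleR_right_distrib)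
  qed
  ultimately show ?thesis
    using sums_unique2[OF heat_sums[OF test_lap[OF f] n, of t]] by simp
qed

lemma heat_deriv:
  assumes f: "test f" and n: "n \<in> V"
  shows "((\<lambda>t. heat f t n) has_vector_derivative heat (lap f) t n) (at t within S)"
  unfolding heat_lap[OF f n]
  by (rule has_vector_derivative_at_within[OF heat_equation[OF group_G one_closed f n]])

lemma continuous_on_heat: "test f \<Longrightarrow> n \<in> V \<Longrightarrow> continuous_on S (\<lambda>t. heat f t n)"
  using heat_deriv continuous_on_vector_derivative by metis

lemma heat_lipschitz:
  assumes f: "test f" and n: "n \<in> V" and s: "s \<in> {0..T}" and t: "t \<in> {0..T}"
  shows "norm (heat f s n - heat f t n) \<le> 3 * \<bar>s - t\<bar> * major T (lap f) n"
proof -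
  let ?M = "major T (lap f) n"
  have b: "norm (heat (lap f) r n) \<le> ?M" if "r \<in> {0..T}" for r
    using that by (intro norm_heat_le test_lap f n) auto
  \<comment> \<open>The derivative varies by at most \<open>2 * ?M\<close>, and the linear term adds
    another \<open>?M\<close>; this gives the constant 3.\<close>
  have "norm (heat f s n - heat f t n - (s - t) *\<^sub>R heat (lap f) t n) \<le> norm (s - t) * (2 * ?M)"
  proof (rule vector_differentiable_bound_linearization[where S = "{0..T}"])
    show "((\<lambda>t. heat f t n) has_vector_derivative heat (lap f) r n) (at r within {0..T})" for r
      by (rule heat_deriv[OF f n])
    show "closed_segment t s \<subseteq> {0..T}"
      using s t by (simp add: closed_segment_subset)
    show "norm (heat (lap f) r n - heat (lap f) t n) \<le> 2 * ?M" if "r \<in> {0..T}" for r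
      using b[OF that] b[OF t] norm_triangle_ineq4[of "heat (lap f) r n" "heat (lap f) t n"] by linarith
  qed (use t in auto)
  moreover have "norm ((s - t) *\<^sub>R heat (lap f) t n) \<le> \<bar>s - t\<bar> * ?M"
    using b[OF t] by (simp add: mult_left_mono)
  ultimately show ?thesis
    using norm_triangle_ineq[of "heat f s n - heat f t n - (s - t) *\<^sub>R heat (lap f) t n" "(s - t) *\<^sub>R heat (lap f) t n"]
    by simp
qed

text \<open>Expansion about the later time, read backwards, hence the plus sign before the
  Laplacian. The remainder is quadratic in the step with a coefficient summable over the
  lattice.\<close>

lemma heat_taylor:
  assumes f: "test f" and n: "n \<in> V" and s: "0 \<le> s" "s \<le> t" and t: "t \<le> T"
  shows "norm (heat f s n - heat f t n + (t - s) *\<^sub>R lap (heat f t) n) \<le> 3 * (t - s)\<^sup>2 * major T (lap (lap f)) n"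
proof -
  let ?M = "major T (lap (lap f)) n"
  have "norm (heat f s n - heat f t n - (s - t) *\<^sub>R heat (lap f) t n) \<le> norm (s - t) * (3 * (t - s) * ?M)"
  proof (rule vector_differentiable_bound_linearization[where S = "{s..t}"])
    show "((\<lambda>t. heat f t n) has_vector_derivative heat (lap f) r n) (at r within {s..t})" for r
      by (rule heat_deriv[OF f n])
    show "closed_segment t s \<subseteq> {s..t}"
      using s by (simp add: closed_segment_subset)
    show "norm (heat (lap f) r n - heat (lap f) t n) \<le> 3 * (t - s) * ?M" if r: "r \<in> {s..t}" for r
    proof -
      have "norm (heat (lap f) r n - heat (lap f) t n) \<le> 3 * \<bar>r - t\<bar> * ?M"
        using s t r by (intro heat_lipschitz test_lap f n) auto
      also have "\<dots> \<le> 3 * (t - s) * ?M"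
        using s t r by (intro mult_right_mono major_nonneg test_lap f n) auto
      finally show ?thesis .
    qed
  qed (use s in auto)
  also have "norm (s - t) * (3 * (t - s) * ?M) = 3 * (t - s)\<^sup>2 * ?M"
    using s by (simp add: power2_eq_square)
  finally show ?thesis
    by (simp add: heat_lap[OF f n] scaleR_left_diff_distrib algebra_simps)
qed

end

section \<open>Monotonicity of the Bellman function along the flow\<close>

lemma antimono_of_local:
  fixes \<psi> :: "real \<Rightarrow> real"
  assumes T: "0 \<le> T" and d: "0 < d"
    and loc: "\<And>s t. 0 \<le> s \<Longrightarrow> s \<le> t \<Longrightarrow> t \<le> T \<Longrightarrow> t - s < d \<Longrightarrow> \<psi> t \<le> \<psi> s"
  shows "\<psi> T \<le> \<psi> 0"
proof -
  obtain M where M: "T / d < real M" using reals_Archimedean2 by blast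
  then have M0: "0 < real M" using T d by (meson divide_nonneg_pos le_less_trans)
  define h where "h = T / real M"
  have h: "0 \<le> h" "h < d" "real M * h = T"
    using T M M0 d by (auto simp: h_def field_simps)
  have "\<psi> (real k * h) \<le> \<psi> 0" if "k \<le> M" for k
    using that
  proof (induction k)
    case (Suc k)
    have "real (Suc k) * h \<le> real M * h"
      using Suc.prems h by (intro mult_right_mono) auto
    then have "\<psi> (real (Suc k) * h) \<le> \<psi> (real k * h)"
      using h by (intro loc) (auto simp: algebra_simps)
    then show ?case using Suc by simp
  qed simp
  from this[of M] show ?thesis using h by simp
qed

text \<open>Replaces the integration of a differential inequality. With the integral of
  \<open>D\<close> added and a small linear drift subtracted, \<open>\<phi>\<close> decreases over
  every sufficiently short step.\<close>

lemma integral_le_of_backward_step: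
  fixes \<phi> D :: "real \<Rightarrow> real"
  assumes T: "0 \<le> T" and C: "0 \<le> C" and D: "continuous_on {0..T} D"
    and step: "\<And>s t. 0 \<le> s \<Longrightarrow> s \<le> t \<Longrightarrow> t \<le> T \<Longrightarrow> \<phi> t + (t - s) * D t \<le> \<phi> s + C * (t - s)\<^sup>2"
  shows "integral {0..T} D \<le> \<phi> 0 - \<phi> T"
proof (rule field_le_epsilon)
  fix e :: real assume e: "0 < e"
  define \<epsilon> where "\<epsilon> = e / (2 * (T + 1))"
  have \<epsilon>: "0 < \<epsilon>" "2 * \<epsilon> * T \<le> e" using e T by (auto simp: \<epsilon>_def field_simps)
  obtain d where d: "0 < d" and unif: "\<And>r t. r \<in> {0..T} \<Longrightarrow> t \<in> {0..T} \<Longrightarrow> dist r t < d \<Longrightarrow> dist (D r) (D t) < \<epsilon>"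
    using compact_uniformly_continuous[OF D] \<epsilon>(1) unfolding uniformly_continuous_on_def by auto
  \<comment> \<open>Of the drift \<open>2 * \<epsilon>\<close>, one half absorbs the oscillation of
    \<open>D\<close> and the other the quadratic error, since
    \<open>C * (t - s) \<le> \<epsilon>\<close>.\<close>
  define d' where "d' = min d (\<epsilon> / (C + 1))"
  define \<psi> where "\<psi> t = \<phi> t + integral {0..t} D - 2 * \<epsilon> * t" for t
  have "\<psi> T \<le> \<psi> 0"
  proof (rule antimono_of_local[OF T])
    show "0 < d'" using d \<epsilon> C by (simp add: d'_def)
    fix s t :: real assume st: "0 \<le> s" "s \<le> t" "t \<le> T" "t - s < d'"
    have int: "D integrable_on {s..t}" "D integrable_on {0..t}"
      using st by (auto intro!: integrable_continuous_real continuous_on_subset[OF D])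
    have "integral {s..t} D \<le> integral {s..t} (\<lambda>_. D t + \<epsilon>)"
    proof (rule integral_le)
      fix r assume r: "r \<in> {s..t}"
      then have "dist (D r) (D t) < \<epsilon>"
        using st by (intro unif) (auto simp: d'_def dist_real_def)
      then show "D r \<le> D t + \<epsilon>" by (simp add: dist_real_def)
    qed (use int in auto)
    also have "\<dots> = (t - s) * (D t + \<epsilon>)" using st by simp
    finally have 1: "integral {s..t} D \<le> (t - s) * (D t + \<epsilon>)" .
    have 2: "integral {0..t} D = integral {0..s} D + integral {s..t} D"
      using st int by (intro Henstock_Kurzweil_Integration.integral_combine[symmetric]) auto
    have "C * (t - s) \<le> (C + 1) * (\<epsilon> / (C + 1))"
      using st C \<epsilon> by (intro mult_mono) (auto simp: d'_def)
    then have "C * (t - s) * (t - s) \<le> \<epsilon> * (t - s)"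
      using st C by (intro mult_right_mono) auto
    with step[OF st(1-3)] 1 2 show "\<psi> t \<le> \<psi> s"
      by (simp add: \<psi>_def algebra_simps power2_eq_square)
  qed
  then show "integral {0..T} D \<le> \<phi> 0 - \<phi> T + e"
    using \<epsilon> by (simp add: \<psi>_def)
qed

context lattice_heat
begin

text \<open>Since \<open>b\<close> is nonnegative, one unit step in the direction of \<open>\<alpha>\<close> or \<open>\<beta>\<close> bounds the subgradient.\<close>
lemma subgradient_bound:
  fixes b :: "complex \<Rightarrow> complex \<Rightarrow> real"
  assumes sub: "\<And>x' g'. b x g + inner \<alpha> (x' - x) + inner \<beta> (g' - g) + norm (x' - x) * norm (g' - g) \<le> b x' g'"
    and pos: "\<And>x g. 0 \<le> b x g" and le: "\<And>x g. b x g \<le> A * norm x powr p + B * norm g powr q"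
    and AB: "0 \<le> A" "0 \<le> B" and pq: "0 \<le> p" "0 \<le> q"
    and K: "norm x \<le> K" "norm g \<le> K"
  shows "norm \<alpha> \<le> A * (K + 1) powr p + B * (K + 1) powr q"
    and "norm \<beta> \<le> A * (K + 1) powr p + B * (K + 1) powr q"
proof -
  have K0: "0 \<le> K" using K norm_ge_zero order_trans by blast
  have sg: "inner a (sgn a) = norm a" for a :: complex
    by (cases "a = 0") (simp_all add: sgn_div_norm power2_norm_eq_inner[symmetric] power2_eq_square)
  have bd: "b y h \<le> A * (K + 1) powr p + B * (K + 1) powr q" if "norm y \<le> K + 1" "norm h \<le> K + 1" for y h
    using le[of y h] AB pq that
    by (smt (verit) mult_left_mono powr_mono2 norm_ge_zero)
  have s1: "norm (y + sgn a) \<le> K + 1" if "norm y \<le> K" for y a :: complex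
    using that norm_triangle_ineq[of y "sgn a"] by (simp add: norm_sgn split: if_splits)
  show "norm \<alpha> \<le> A * (K + 1) powr p + B * (K + 1) powr q"
    using sub[of "x + sgn \<alpha>" g] pos[of x g] bd[OF s1[OF K(1)], of g \<alpha>] K by (simp add: sg)
  show "norm \<beta> \<le> A * (K + 1) powr p + B * (K + 1) powr q"
    using sub[of x "g + sgn \<beta>"] pos[of x g] bd[OF _ s1[OF K(2)], of x \<beta>] K by (simp add: sg)
qed

section \<open>Lattice sums of the Bellman function\<close>

definition edge :: "((nat \<Rightarrow> int) \<Rightarrow> complex) \<Rightarrow> ((nat \<Rightarrow> int) \<Rightarrow> complex) \<Rightarrow> nat \<Rightarrow> (nat \<Rightarrow> int) \<Rightarrow> real"
  where "edge u v i n = norm (fwd_diff N G i u n) * norm (fwd_diff N G i v n)"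

lemma edge_nonneg [simp]: "0 \<le> edge u v i n"
  by (simp add: edge_def)

text \<open>The supporting plane is tested at all neighbours, and its linear terms add up to
  Laplacians. The gain at a backward neighbour belongs to the edge starting there, so summation over
  the lattice counts every edge twice: this is the factor 2 of the theorem.\<close>

lemma lap_subgradient:
  fixes b :: "complex \<Rightarrow> complex \<Rightarrow> real"
  assumes sub: "\<And>x' g'. b (u n) (v n) + inner \<alpha> (x' - u n) + inner \<beta> (g' - v n)
      + norm (x' - u n) * norm (g' - v n) \<le> b x' g'"
    and n: "n \<in> V"
  shows "inner \<alpha> (lap u n) + inner \<beta> (lap v n) + (\<Sum>i=1..N. edge u v i n + edge u v i (bw i n))
      + (\<Sum>i=1..N. 2 * b (u n) (v n)) \<le> (\<Sum>i=1..N. b (u (fw i n)) (v (fw i n)) + b (u (bw i n)) (v (bw i n)))"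
proof -
  have split: "x - 2 * y + z = (x - y) + (z - y)" for x y z :: complex by simp
  have "inner \<alpha> (u (fw i n) - 2 * u n + u (bw i n)) + inner \<beta> (v (fw i n) - 2 * v n + v (bw i n))
      + (edge u v i n + edge u v i (bw i n)) + 2 * b (u n) (v n)
      \<le> b (u (fw i n)) (v (fw i n)) + b (u (bw i n)) (v (bw i n))" for i
  proof -
    have "edge u v i n = norm (u (fw i n) - u n) * norm (v (fw i n) - v n)"
      "edge u v i (bw i n) = norm (u (bw i n) - u n) * norm (v (bw i n) - v n)"
      using n by (simp_all add: edge_def fwd_diff_eq norm_minus_commute)
    then show ?thesis
      using sub[of "u (fw i n)" "v (fw i n)"] sub[of "u (bw i n)" "v (bw i n)"]
      unfolding split inner_add_right by linarith
  qed
  then have "(\<Sum>i=1..N. inner \<alpha> (u (fw i n) - 2 * u n + u (bw i n)) + inner \<beta> (v (fw i n) - 2 * v n + v (bw i n))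
      + (edge u v i n + edge u v i (bw i n)) + 2 * b (u n) (v n))
      \<le> (\<Sum>i=1..N. b (u (fw i n)) (v (fw i n)) + b (u (bw i n)) (v (bw i n)))"
    by (intro sum_mono)
  then show ?thesis
    unfolding lap_eq[OF n] inner_sum_right by (simp only: sum.distrib)
qed

text \<open>General \<open>A\<close> and \<open>B\<close> admit rescaled Bellman functions; a finite
  \<open>S\<close> keeps the integrand continuous in time.\<close>

lemma bellman_flow:
  fixes b :: "complex \<Rightarrow> complex \<Rightarrow> real" and A B p q T :: real
  assumes pos: "\<And>x g. 0 \<le> b x g"
    and le: "\<And>x g. b x g \<le> A * norm x powr p + B * norm g powr q"
    and AB: "0 \<le> A" "0 \<le> B" and pq: "1 \<le> p" "1 \<le> q"
    and sub: "\<And>x g. \<exists>\<alpha> \<beta>. \<forall>x' g'.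
      b x g + inner \<alpha> (x' - x) + inner \<beta> (g' - g) + norm (x' - x) * norm (g' - g) \<le> b x' g'"
    and f: "test f" and g: "test g" and S: "finite S" "S \<subseteq> V" and T: "0 \<le> T"
  shows "integral {0..T} (\<lambda>t. 2 * (\<Sum>i=1..N. \<Sum>n\<in>S. edge (heat f t) (heat g t) i n))
    \<le> A * infsum (\<lambda>n. norm (f n) powr p) V + B * infsum (\<lambda>n. norm (g n) powr q) V"
proof -
  define \<phi> where "\<phi> t = infsum (\<lambda>n. b (heat f t n) (heat g t n)) V" for t
  define Mf where "Mf = major T f"
  define Mg where "Mg = major T g"
  define M2 where "M2 n = major T (lap (lap f)) n + major T (lap (lap g)) n" for n
  \<comment> \<open>\<open>K\<close> bounds both heat extensions for all \<open>n\<close> and all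
    times up to \<open>T\<close>; \<open>L\<close> bounds the supporting slopes at such
    values.\<close>
  define K where "K = infsum Mf V + infsum Mg V"
  define L where "L = A * (K + 1) powr p + B * (K + 1) powr q"
  have sumM: "Mf summable_on V" "Mg summable_on V" "M2 summable_on V"
    unfolding Mf_def Mg_def M2_def by (intro summable_on_add major_summable_on f g test_lap T)+
  have M0: "0 \<le> Mf n" "0 \<le> Mg n" "0 \<le> M2 n" if "n \<in> V" for n
    unfolding Mf_def Mg_def M2_def using that by (auto intro!: add_nonneg_nonneg major_nonneg f g test_lap T)
  have MK: "Mf n \<le> K" "Mg n \<le> K" if "n \<in> V" for n
  proof -
    have "Mf n \<le> infsum Mf V" "Mg n \<le> infsum Mg V"
      using finite_sum_le_infsum[OF sumM(1), of "{n}"] finite_sum_le_infsum[OF sumM(2), of "{n}"] M0 that by auto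
    moreover have "0 \<le> infsum Mf V" "0 \<le> infsum Mg V" using M0 by (auto intro: infsum_nonneg)
    ultimately show "Mf n \<le> K" "Mg n \<le> K" by (auto simp: K_def)
  qed
  have K0: "0 \<le> K" using M0 by (auto simp: K_def intro!: add_nonneg_nonneg infsum_nonneg)
  have L0: "0 \<le> L" using AB by (simp add: L_def)
  have hf: "norm (heat f t n) \<le> Mf n" and hg: "norm (heat g t n) \<le> Mg n" if "n \<in> V" "0 \<le> t" "t \<le> T" for t n
    unfolding Mf_def Mg_def using that by (intro norm_heat_le f g; simp)+
  \<comment> \<open>Reduces summability of the powers to that of the majorants.\<close>
  have powr_bd: "x powr r \<le> K powr (r - 1) * m" if "0 \<le> x" "x \<le> m" "m \<le> K" "1 \<le> r" for x m r :: real
  proof (cases "x = 0")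
    case True
    then show ?thesis using that by (simp add: order_trans)
  next
    case False
    then have "x powr r = x powr (r - 1) * x"
      using that powr_add[of x "r - 1" 1] by simp
    also have "\<dots> \<le> K powr (r - 1) * m"
      using that by (intro mult_mono powr_mono2) auto
    finally show ?thesis .
  qed
  have sumb: "(\<lambda>n. b (heat f t n) (heat g t n)) summable_on V" if t: "0 \<le> t" "t \<le> T" for t
  proof (rule summable_on_comparison_test)
    show "(\<lambda>n. A * (K powr (p - 1) * Mf n) + B * (K powr (q - 1) * Mg n)) summable_on V"
      by (intro summable_on_add summable_on_cmult_right sumM)
    fix n assume n: "n \<in> V"
    have "norm (heat f t n) powr p \<le> K powr (p - 1) * Mf n" "norm (heat g t n) powr q \<le> K powr (q - 1) * Mg n"
      using hf[OF n t] hg[OF n t] MK[OF n] pq by (auto intro: powr_bd)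
    then show "b (heat f t n) (heat g t n) \<le> A * (K powr (p - 1) * Mf n) + B * (K powr (q - 1) * Mg n)"
      using le[of "heat f t n" "heat g t n"] AB by (smt (verit) mult_left_mono)
  qed (rule pos)
  have sume: "edge (heat f t) (heat g t) i summable_on V" if t: "0 \<le> t" "t \<le> T" for t i
  proof (rule summable_on_comparison_test)
    have "(Mf has_sum infsum Mf V) V" using sumM by simp
    then have "(\<lambda>n. Mf (fw i n)) summable_on V" by (rule has_sum_imp_summable[OF has_sum_shift(1)])
    then show "(\<lambda>n. 2 * K * (Mf (fw i n) + Mf n)) summable_on V"
      by (intro summable_on_cmult_right summable_on_add sumM)
    fix n assume n: "n \<in> V"
    have "norm (fwd_diff N G i (heat f t) n) \<le> Mf (fw i n) + Mf n"
      unfolding fwd_diff_eq using n t by (intro norm_triangle_le_diff add_mono hf) auto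
    moreover have "norm (fwd_diff N G i (heat g t) n) \<le> Mg (fw i n) + Mg n"
      unfolding fwd_diff_eq using n t by (intro norm_triangle_le_diff add_mono hg) auto
    moreover have "Mg (fw i n) + Mg n \<le> 2 * K" using MK(2)[of n] MK(2)[of "fw i n"] n by simp
    ultimately have "edge (heat f t) (heat g t) i n \<le> (Mf (fw i n) + Mf n) * (2 * K)"
      unfolding edge_def using M0 n by (intro mult_mono) auto
    then show "edge (heat f t) (heat g t) i n \<le> 2 * K * (Mf (fw i n) + Mf n)" by (simp add: mult_ac)
  qed simp
  let ?D = "\<lambda>t. 2 * (\<Sum>i=1..N. \<Sum>n\<in>S. edge (heat f t) (heat g t) i n)"
  have step: "\<phi> t + (t - s) * ?D t \<le> \<phi> s + (3 * L * infsum M2 V) * (t - s)\<^sup>2"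
    if st: "0 \<le> s" "s \<le> t" "t \<le> T" for s t
  proof -
    define h where "h = t - s"
    define u where "u = heat f t"
    define v where "v = heat g t"
    define w where "w n = b (u n) (v n)" for n
    define E where "E i = infsum (edge u v i) V" for i
    have h: "0 \<le> h" using st by (simp add: h_def)
    have sw: "(w has_sum \<phi> t) V"
      unfolding w_def u_def v_def \<phi>_def using sumb st by simp
    have sE: "(edge u v i has_sum E i) V" for i
      unfolding E_def u_def v_def using sume st by simp
    have ss: "((\<lambda>n. b (heat f s n) (heat g s n)) has_sum \<phi> s) V"
      unfolding \<phi>_def using sumb st by simp
    have sM: "(M2 has_sum infsum M2 V) V" using sumM by simp
    \<comment> \<open>The supporting plane at time \<open>t\<close> is tested with the values at
      time \<open>s\<close>. To first order these are \<open>u - h * lap u\<close> and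
      \<open>v - h * lap v\<close>, so \<open>lap_subgradient\<close> enters with the favourable
      sign.\<close>
    have "w n + h * (\<Sum>i=1..N. edge u v i n + edge u v i (bw i n)) + h * (\<Sum>i=1..N. 2 * w n)
        \<le> b (heat f s n) (heat g s n) + h * (\<Sum>i=1..N. w (fw i n) + w (bw i n)) + 3 * L * h\<^sup>2 * M2 n"
      if n: "n \<in> V" for n
    proof -
      obtain \<alpha> \<beta> where \<alpha>\<beta>: "\<And>x' g'. b (u n) (v n) + inner \<alpha> (x' - u n) + inner \<beta> (g' - v n)
          + norm (x' - u n) * norm (g' - v n) \<le> b x' g'"
        using sub by metis
      have "norm (u n) \<le> K" "norm (v n) \<le> K"
        unfolding u_def v_def using hf[OF n, of t] hg[OF n, of t] MK[OF n] st by auto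
      from subgradient_bound[OF \<alpha>\<beta> pos le AB _ _ this] pq
      have \<alpha>L: "norm \<alpha> \<le> L" and \<beta>L: "norm \<beta> \<le> L" by (auto simp: L_def)
      define ef where "ef = heat f s n - u n + h *\<^sub>R lap u n"
      define eg where "eg = heat g s n - v n + h *\<^sub>R lap v n"
      have "norm ef \<le> 3 * h\<^sup>2 * major T (lap (lap f)) n" "norm eg \<le> 3 * h\<^sup>2 * major T (lap (lap g)) n"
        unfolding ef_def eg_def u_def v_def h_def using st n by (intro heat_taylor f g; simp)+
      then have "\<bar>inner \<alpha> ef\<bar> \<le> L * (3 * h\<^sup>2 * major T (lap (lap f)) n)"
        "\<bar>inner \<beta> eg\<bar> \<le> L * (3 * h\<^sup>2 * major T (lap (lap g)) n)"
        using \<alpha>L \<beta>L L0 by (auto intro!: order_trans[OF Cauchy_Schwarz_ineq2] mult_mono)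
      then have err: "- (inner \<alpha> ef + inner \<beta> eg) \<le> 3 * L * h\<^sup>2 * M2 n"
        by (simp add: M2_def algebra_simps)
      have "b (u n) (v n) + inner \<alpha> (heat f s n - u n) + inner \<beta> (heat g s n - v n) \<le> b (heat f s n) (heat g s n)"
        using \<alpha>\<beta>[of "heat f s n" "heat g s n"] by (smt (verit) mult_nonneg_nonneg norm_ge_zero)
      moreover have "inner \<alpha> (heat f s n - u n) = inner \<alpha> ef - h * inner \<alpha> (lap u n)"
        "inner \<beta> (heat g s n - v n) = inner \<beta> eg - h * inner \<beta> (lap v n)"
        by (simp_all add: ef_def eg_def inner_add_right)
      moreover note mult_left_mono[OF lap_subgradient[of b u n v \<alpha> \<beta>, OF \<alpha>\<beta> n] h]
      ultimately show ?thesis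
        using err unfolding w_def by (simp only: distrib_left)
    qed
    note pointwise = this
    \<comment> \<open>After summation over \<open>V\<close> the terms with
      \<open>h * \<phi> t\<close> agree on both sides.\<close>
    have "\<phi> t + h * (\<Sum>i=1..N. E i + E i) + h * (\<Sum>i=1..N. 2 * \<phi> t)
        \<le> \<phi> s + h * (\<Sum>i=1..N. \<phi> t + \<phi> t) + 3 * L * h\<^sup>2 * infsum M2 V"
    proof (rule has_sum_mono)
      show "((\<lambda>n. w n + h * (\<Sum>i=1..N. edge u v i n + edge u v i (bw i n)) + h * (\<Sum>i=1..N. 2 * w n))
          has_sum \<phi> t + h * (\<Sum>i=1..N. E i + E i) + h * (\<Sum>i=1..N. 2 * \<phi> t)) V"
        by (intro has_sum_add has_sum_cmult_right has_sum_finite_sum has_sum_shift sw sE finite_atLeastAtMost)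
      show "((\<lambda>n. b (heat f s n) (heat g s n) + h * (\<Sum>i=1..N. w (fw i n) + w (bw i n)) + 3 * L * h\<^sup>2 * M2 n)
          has_sum \<phi> s + h * (\<Sum>i=1..N. \<phi> t + \<phi> t) + 3 * L * h\<^sup>2 * infsum M2 V) V"
        by (intro has_sum_add has_sum_cmult_right has_sum_finite_sum has_sum_shift sw ss sM finite_atLeastAtMost)
    qed (rule pointwise)
    moreover have "h * ?D t \<le> h * (\<Sum>i=1..N. E i + E i)"
    proof -
      have "(\<Sum>n\<in>S. edge u v i n) \<le> E i" for i
        unfolding E_def using S has_sum_imp_summable[OF sE] by (intro finite_sum_le_infsum) auto
      then have "(\<Sum>i=1..N. \<Sum>n\<in>S. edge u v i n) \<le> (\<Sum>i=1..N. E i)"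
        by (intro sum_mono)
      then show ?thesis
        using h by (intro mult_left_mono) (auto simp: u_def v_def sum.distrib sum_distrib_left[symmetric])
    qed
    ultimately show ?thesis
      by (simp add: h_def mult_ac sum.distrib)
  qed
  have "integral {0..T} ?D \<le> \<phi> 0 - \<phi> T"
  proof (rule integral_le_of_backward_step[OF T _ _ step])
    show "0 \<le> 3 * L * infsum M2 V"
      using L0 M0 by (intro mult_nonneg_nonneg infsum_nonneg) auto
    show "continuous_on {0..T} ?D"
      unfolding edge_def fwd_diff_eq using S
      by (intro continuous_intros continuous_on_heat f g) auto
  qed
  also have "\<dots> \<le> \<phi> 0" using pos by (simp add: \<phi>_def infsum_nonneg)
  also have "\<dots> \<le> A * infsum (\<lambda>n. norm (f n) powr p) V + B * infsum (\<lambda>n. norm (g n) powr q) V"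
  proof -
    have fin: "(\<lambda>n. norm (k n) powr r) summable_on V" if "test k" for k :: "(nat \<Rightarrow> int) \<Rightarrow> complex" and r
    proof -
      have "(\<lambda>n. norm (k n) powr r) summable_on {n \<in> V. k n \<noteq> 0}"
        using that by (intro summable_on_finite) (simp add: test_function_def)
      then show ?thesis
        by (rule summable_on_cong_neutral[THEN iffD1, rotated -1]) auto
    qed
    show ?thesis
    proof (rule has_sum_mono)
      show "((\<lambda>n. b (heat f 0 n) (heat g 0 n)) has_sum \<phi> 0) V"
        unfolding \<phi>_def using sumb[of 0] T by simp
      show "((\<lambda>n. A * norm (f n) powr p + B * norm (g n) powr q) has_sum
          A * infsum (\<lambda>n. norm (f n) powr p) V + B * infsum (\<lambda>n. norm (g n) powr q) V) V"
        by (intro has_sum_add has_sum_cmult_right has_sum_infsum fin f g)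
    qed (simp add: heat_ext_0 le)
  qed
  finally show ?thesis .
qed

end

section \<open>The bilinear estimate\<close>

lemma nn_integral_count_space_SUP:
  assumes V: "countable V"
  obtains S :: "nat \<Rightarrow> 'a set" where "incseq S" "\<And>k. finite (S k)" "\<And>k. S k \<subseteq> V"
    "\<And>f. (\<integral>\<^sup>+n. f n \<partial>count_space V) = (SUP k. \<Sum>n\<in>S k. f n)"
proof -
  \<comment> \<open>One exhaustion serves all functions, hence all times \<open>t\<close>
    simultaneously.\<close>
  define S where "S k = {x \<in> V. to_nat_on V x \<le> k}" for k
  have S: "incseq S" "S k \<subseteq> V" for k by (auto simp: S_def incseq_def)
  have fin: "finite (S k)" for k
    by (rule inj_on_finite[of "to_nat_on V" _ "{..k}"])
      (auto simp: S_def intro: inj_on_subset[OF inj_on_to_nat_on[OF V]])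
  have "(\<integral>\<^sup>+n. f n \<partial>count_space V) = (SUP k. \<Sum>n\<in>S k. f n)" for f :: "'a \<Rightarrow> ennreal"
  proof -
    have "(\<integral>\<^sup>+n. f n \<partial>count_space V) = (\<integral>\<^sup>+n. (SUP k. f n * indicator (S k) n) \<partial>count_space V)"
    proof (rule nn_integral_cong)
      fix n assume "n \<in> space (count_space V)"
      then have "f n * indicator (S (to_nat_on V n)) n = f n" by (simp add: S_def)
      then have "f n \<le> (SUP k. f n * indicator (S k) n)"
        by (metis SUP_upper UNIV_I)
      moreover have "(SUP k. f n * indicator (S k) n) \<le> f n"
        by (intro SUP_least) (simp add: indicator_def)
      ultimately show "f n = (SUP k. f n * indicator (S k) n)" by (rule antisym)
    qed
    also have "\<dots> = (SUP k. \<integral>\<^sup>+n. f n * indicator (S k) n \<partial>count_space V)"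
      using S(1) by (intro nn_integral_monotone_convergence_SUP)
        (auto simp: incseq_def le_fun_def indicator_def)
    also have "\<dots> = (SUP k. \<Sum>n\<in>S k. f n)"
    proof (rule SUP_cong[OF refl])
      fix k
      have "(\<integral>\<^sup>+n. f n * indicator (S k) n \<partial>count_space V) = (\<Sum>n\<in>S k. f n * indicator (S k) n)"
        using fin S by (intro nn_integral_count_space') auto
      then show "(\<integral>\<^sup>+n. f n * indicator (S k) n \<partial>count_space V) = (\<Sum>n\<in>S k. f n)" by simp
    qed
    finally show ?thesis .
  qed
  then show ?thesis using that S fin by metis
qed

context lattice_heat
begin

definition energy :: "((nat \<Rightarrow> int) \<Rightarrow> complex) \<Rightarrow> ((nat \<Rightarrow> int) \<Rightarrow> complex) \<Rightarrow> ennreal"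
  where "energy f g = 2 * (\<Sum>i=1..N. \<integral>\<^sup>+t\<in>{0..}. (\<integral>\<^sup>+n. ennreal (edge (heat f t) (heat g t) i n)
          \<partial>count_space V) \<partial>lborel)"

text \<open>Monotone convergence along \<open>S k\<close> and \<open>{0..real k}\<close> jointly; on
  each piece the integrand is continuous, so its Lebesgue integral is the one in
  \<open>le\<close>.\<close>

lemma energy_le:
  assumes V: "countable V" and f: "test f" and g: "test g" and C: "0 \<le> C"
    and le: "\<And>S T. finite S \<Longrightarrow> S \<subseteq> V \<Longrightarrow> 0 \<le> T \<Longrightarrow>
      integral {0..T} (\<lambda>t. 2 * (\<Sum>i=1..N. \<Sum>n\<in>S. edge (heat f t) (heat g t) i n)) \<le> C"
  shows "energy f g \<le> ennreal C"
proof -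
  define e where "e i n t = edge (heat f t) (heat g t) i n" for i n t
  have e0: "0 \<le> e i n t" for i n t by (simp add: e_def)
  have cont: "continuous_on A (e i n)" if "n \<in> V" for A i n
    unfolding e_def edge_def fwd_diff_eq using that
    by (intro continuous_intros continuous_on_heat f g) auto
  have meas: "e i n \<in> borel_measurable borel" if "n \<in> V" for i n
    by (rule borel_measurable_continuous_onI[OF cont[OF that]])
  obtain S :: "nat \<Rightarrow> (nat \<Rightarrow> int) set" where S: "incseq S" "\<And>k. finite (S k)" "\<And>k. S k \<subseteq> V"
    and SUP: "\<And>h. (\<integral>\<^sup>+n. h n \<partial>count_space V) = (SUP k. \<Sum>n\<in>S k. h n)"
    using nn_integral_count_space_SUP[OF V] by metis
  have mJ: "(\<lambda>t. (\<Sum>n\<in>S k. ennreal (e i n t)) * indicator {0..real k} t) \<in> borel_measurable lborel" for i k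
  proof -
    have [measurable]: "e i n \<in> borel_measurable borel" if "n \<in> S k" for n
      using meas S(3) that by blast
    show ?thesis by measurable
  qed
  have mono: "(\<Sum>n\<in>S k. ennreal (e i n t)) * indicator {0..real k} t
      \<le> (\<Sum>n\<in>S l. ennreal (e i n t)) * indicator {0..real l} t" if "k \<le> l" for k l i t
    using S that by (intro mult_mono sum_mono2) (auto simp: incseq_def indicator_def)
  define J where "J i k = (\<integral>\<^sup>+t. (\<Sum>n\<in>S k. ennreal (e i n t)) * indicator {0..real k} t \<partial>lborel)" for i k
  have "(\<integral>\<^sup>+t\<in>{0..}. (\<integral>\<^sup>+n. ennreal (e i n t) \<partial>count_space V) \<partial>lborel) \<le> (SUP k. J i k)" for i
  proof -
    have "(\<integral>\<^sup>+t\<in>{0..}. (\<integral>\<^sup>+n. ennreal (e i n t) \<partial>count_space V) \<partial>lborel)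
        \<le> (\<integral>\<^sup>+t. (SUP k. (\<Sum>n\<in>S k. ennreal (e i n t)) * indicator {0..real k} t) \<partial>lborel)"
    proof (rule nn_integral_mono)
      fix t :: real
      show "(\<integral>\<^sup>+n. ennreal (e i n t) \<partial>count_space V) * indicator {0..} t
          \<le> (SUP k. (\<Sum>n\<in>S k. ennreal (e i n t)) * indicator {0..real k} t)"
      proof (cases "0 \<le> t")
        case True
        obtain m where m: "t \<le> real m" using real_arch_simple by blast
        have "(\<Sum>n\<in>S k. ennreal (e i n t)) \<le> (\<Sum>n\<in>S (max k m). ennreal (e i n t)) * indicator {0..real (max k m)} t" for k
        proof -
          have "indicator {0..real (max k m)} t = (1::ennreal)" using m True by auto
          moreover have "(\<Sum>n\<in>S k. ennreal (e i n t)) \<le> (\<Sum>n\<in>S (max k m). ennreal (e i n t))"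
            using S by (intro sum_mono2) (auto simp: incseq_def intro: rev_subsetD)
          ultimately show ?thesis by simp
        qed
        then have "(SUP k. \<Sum>n\<in>S k. ennreal (e i n t)) \<le> (SUP k. (\<Sum>n\<in>S k. ennreal (e i n t)) * indicator {0..real k} t)"
          by (intro SUP_mono) blast
        then show ?thesis using True by (simp add: SUP)
      qed simp
    qed
    also have "\<dots> = (SUP k. J i k)"
      unfolding J_def
    proof (rule nn_integral_monotone_convergence_SUP)
      show "incseq (\<lambda>k t. (\<Sum>n\<in>S k. ennreal (e i n t)) * indicator {0..real k} t)"
        using mono by (auto simp: incseq_def le_fun_def)
      show "(\<lambda>t. (\<Sum>n\<in>S k. ennreal (e i n t)) * indicator {0..real k} t) \<in> borel_measurable lborel" for k
        by (rule mJ)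
    qed
    finally show ?thesis .
  qed
  then have "energy f g \<le> 2 * (\<Sum>i=1..N. SUP k. J i k)"
    unfolding energy_def e_def[symmetric] by (intro mult_left_mono sum_mono) auto
  also have "(\<Sum>i=1..N. SUP k. J i k) = (SUP k. \<Sum>i=1..N. J i k)"
    using mono unfolding J_def
    by (intro ennreal_SUP_sum[symmetric]) (auto simp: incseq_def intro!: nn_integral_mono)
  also have "2 * \<dots> = (SUP k. 2 * (\<Sum>i=1..N. J i k))"
    by (rule SUP_mult_left_ennreal)
  also have "\<dots> \<le> ennreal C"
  proof (rule SUP_least)
    fix k
    let ?D = "\<lambda>t. 2 * (\<Sum>i=1..N. \<Sum>n\<in>S k. e i n t)"
    have "2 * (\<Sum>i=1..N. J i k) = (\<integral>\<^sup>+t. 2 * (\<Sum>i=1..N. (\<Sum>n\<in>S k. ennreal (e i n t)) * indicator {0..real k} t) \<partial>lborel)"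
      unfolding J_def nn_integral_sum[OF mJ, symmetric]
      by (intro nn_integral_cmult[symmetric] borel_measurable_sum mJ)
    also have "\<dots> = (\<integral>\<^sup>+t. ennreal (?D t) * indicator {0..real k} t \<partial>lborel)"
      using e0 by (intro nn_integral_cong)
        (simp add: sum_ennreal sum_nonneg ennreal_mult sum_distrib_right[symmetric] mult.assoc)
    also have "\<dots> = ennreal (integral {0..real k} ?D)"
    proof (rule nn_integral_has_integral_lebesgue')
      have "continuous_on {0..real k} ?D"
        using S(3)[of k] by (intro continuous_intros cont) auto
      then show "(?D has_integral integral {0..real k} ?D) {0..real k}"
        by (intro integrable_integral integrable_continuous_real)
    qed (simp add: e0 sum_nonneg)
    also have "\<dots> \<le> ennreal C"
      unfolding e_def using S by (intro ennreal_leI le) auto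
    finally show "2 * (\<Sum>i=1..N. J i k) \<le> ennreal C" .
  qed
  finally show ?thesis .
qed

section \<open>Scaling and the product of the norms\<close>

lemma energy_commute: "energy f g = energy g f"
  by (simp add: energy_def edge_def mult.commute)

text \<open>Passing from \<open>b\<close> to \<open>b'\<close> preserves the gain, because the
  factors \<open>c\<close> and \<open>1 / c\<close> cancel in it; only the constants of the size
  bound change.\<close>

lemma energy_le_scaled:
  assumes p: "2 \<le> p" and q: "q = p / (p - 1)" and V: "countable V" and f: "test f" and g: "test g"
    and c: "0 < c"
  shows "energy f g \<le> ennreal ((p - 1) * (c powr p * infsum (\<lambda>n. norm (f n) powr p) V / p
    + c powr - q * infsum (\<lambda>n. norm (g n) powr q) V / q))"
proof -
  have q1: "1 < q" using p by (simp add: q)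
  obtain b :: "complex \<Rightarrow> complex \<Rightarrow> real"
  where pos: "\<And>x g. 0 \<le> b x g"
    and le: "\<And>x g. b x g \<le> (p - 1) * (norm x powr p / p + norm g powr q / q)"
    and sub: "\<And>x g. \<exists>\<alpha> \<beta>. \<forall>x' g'.
      b x g + inner \<alpha> (x' - x) + inner \<beta> (g' - g) + norm (x' - x) * norm (g' - g) \<le> b x' g'"
    using bellman_function_exists[OF p q] by blast
  define b' where "b' x g = b (c *\<^sub>R x) ((1 / c) *\<^sub>R g)" for x g
  let ?A = "(p - 1) * (c powr p / p)" and ?B = "(p - 1) * (c powr - q / q)"
  have le': "b' x g \<le> ?A * norm x powr p + ?B * norm g powr q" for x g
    using le[of "c *\<^sub>R x" "(1 / c) *\<^sub>R g"] c
    by (simp add: b'_def powr_mult powr_divide powr_minus_divide algebra_simps)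
  have sub': "\<exists>\<alpha> \<beta>. \<forall>x' g'.
      b' x g + inner \<alpha> (x' - x) + inner \<beta> (g' - g) + norm (x' - x) * norm (g' - g) \<le> b' x' g'" for x g
  proof -
    obtain \<alpha> \<beta> where \<alpha>\<beta>: "\<And>x' g'. b (c *\<^sub>R x) ((1 / c) *\<^sub>R g) + inner \<alpha> (x' - c *\<^sub>R x) + inner \<beta> (g' - (1 / c) *\<^sub>R g)
        + norm (x' - c *\<^sub>R x) * norm (g' - (1 / c) *\<^sub>R g) \<le> b x' g'"
      using sub by metis
    have "b' x g + inner (c *\<^sub>R \<alpha>) (x' - x) + inner ((1 / c) *\<^sub>R \<beta>) (g' - g) + norm (x' - x) * norm (g' - g) \<le> b' x' g'"
      for x' g'
    proof -
      have "norm (c *\<^sub>R x' - c *\<^sub>R x) * norm ((1 / c) *\<^sub>R g' - (1 / c) *\<^sub>R g) = norm (x' - x) * norm (g' - g)"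
        using c by (simp flip: scaleR_right_diff_distrib)
      then show ?thesis
        using \<alpha>\<beta>[of "c *\<^sub>R x'" "(1 / c) *\<^sub>R g'"] by (simp add: b'_def inner_diff_right algebra_simps)
    qed
    then show ?thesis by blast
  qed
  have "energy f g \<le> ennreal (?A * infsum (\<lambda>n. norm (f n) powr p) V + ?B * infsum (\<lambda>n. norm (g n) powr q) V)"
  proof (rule energy_le[OF V f g])
    show "0 \<le> ?A * infsum (\<lambda>n. norm (f n) powr p) V + ?B * infsum (\<lambda>n. norm (g n) powr q) V"
      using p q1 by (intro add_nonneg_nonneg mult_nonneg_nonneg infsum_nonneg) auto
    show "integral {0..T} (\<lambda>t. 2 * (\<Sum>i=1..N. \<Sum>n\<in>S. edge (heat f t) (heat g t) i n))
      \<le> ?A * infsum (\<lambda>n. norm (f n) powr p) V + ?B * infsum (\<lambda>n. norm (g n) powr q) V"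
      if "finite S" "S \<subseteq> V" "0 \<le> T" for S T
      using p q1 that by (intro bellman_flow[of b', OF _ le' _ _ _ _ sub' f g]) (auto simp: b'_def pos)
  qed
  then show ?thesis by (simp add: algebra_simps)
qed

lemma energy_le_powr:
  assumes p: "2 \<le> p" and q: "q = p / (p - 1)" and V: "countable V" and f: "test f" and g: "test g"
  shows "energy f g \<le> ennreal ((p - 1) * infsum (\<lambda>n. norm (f n) powr p) V powr (1 / p)
    * infsum (\<lambda>n. norm (g n) powr q) V powr (1 / q))"
proof -
  let ?F = "infsum (\<lambda>n. norm (f n) powr p) V" and ?G = "infsum (\<lambda>n. norm (g n) powr q) V"
  have FG: "0 \<le> ?F" "0 \<le> ?G" by (auto intro: infsum_nonneg)
  have q1: "1 < q" and pq: "1 / p + 1 / q = 1" using p by (auto simp: q field_simps)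
  \<comment> \<open>A positive \<open>e\<close> avoids zero bases when a norm vanishes; it is
    removed in the limit.\<close>
  have bound: "energy f g \<le> ennreal ((p - 1) * (?F + e) powr (1 / p) * (?G + e) powr (1 / q))"
    if e: "0 < e" for e
  proof -
    \<comment> \<open>This choice makes both terms equal to \<open>?R\<close> before division by
      \<open>p\<close> and \<open>q\<close>, and \<open>1 / p + 1 / q = 1\<close>.\<close>
    define c where "c = (?F + e) powr (- 1 / (p * q)) * (?G + e) powr (1 / (p * q))"
    have exps: "- 1 / q + 1 = 1 / p" "- 1 / p + 1 = 1 / q" using pq by simp_all
    have pos: "0 < ?F + e" "0 < ?G + e" using FG e by auto
    then have c: "0 < c" by (simp add: c_def)
    have "c powr p * (?F + e) = (?F + e) powr (- 1 / q) * (?F + e) powr 1 * (?G + e) powr (1 / q)"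
      using pos p q1 by (simp add: c_def powr_mult powr_powr)
    also have "\<dots> = (?F + e) powr (1 / p) * (?G + e) powr (1 / q)"
      by (simp only: powr_add[symmetric] exps)
    finally have 1: "c powr p * (?F + e) = (?F + e) powr (1 / p) * (?G + e) powr (1 / q)" .
    have "c powr - q * (?G + e) = (?F + e) powr (1 / p) * ((?G + e) powr (- 1 / p) * (?G + e) powr 1)"
      using pos p q1 by (simp add: c_def powr_mult powr_powr)
    also have "\<dots> = (?F + e) powr (1 / p) * (?G + e) powr (1 / q)"
      by (simp only: powr_add[symmetric] exps)
    finally have 2: "c powr - q * (?G + e) = (?F + e) powr (1 / p) * (?G + e) powr (1 / q)" .
    let ?R = "(?F + e) powr (1 / p) * (?G + e) powr (1 / q)"
    have "energy f g \<le> ennreal ((p - 1) * (c powr p * ?F / p + c powr - q * ?G / q))"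
      by (rule energy_le_scaled[OF p q V f g c])
    also have "\<dots> \<le> ennreal ((p - 1) * (c powr p * (?F + e) / p + c powr - q * (?G + e) / q))"
      using p q1 e by (intro ennreal_leI mult_left_mono add_mono divide_right_mono) auto
    also have "c powr p * (?F + e) / p + c powr - q * (?G + e) / q = ?R * (1 / p + 1 / q)"
      unfolding 1 2 by (simp only: distrib_left times_divide_eq_right mult_1_right)
    finally show ?thesis unfolding pq by (simp add: mult.assoc)
  qed
  have "(\<lambda>k. ennreal ((p - 1) * (?F + 1 / real (Suc k)) powr (1 / p) * (?G + 1 / real (Suc k)) powr (1 / q)))
      \<longlonglongrightarrow> ennreal ((p - 1) * (?F + 0) powr (1 / p) * (?G + 0) powr (1 / q))"
  proof (intro tendsto_ennrealI tendsto_mult tendsto_const tendsto_powr' tendsto_add)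
    show "(\<lambda>k. 1 / real (Suc k)) \<longlonglongrightarrow> 0" by (rule LIMSEQ_Suc[OF lim_const_over_n])
    show "(\<lambda>k. 1 / real (Suc k)) \<longlonglongrightarrow> 0" by (rule LIMSEQ_Suc[OF lim_const_over_n])
  qed (use p q1 FG in \<open>auto intro!: always_eventually add_nonneg_nonneg\<close>)
  then show ?thesis
    by (intro tendsto_lowerbound[of _ _ sequentially]) (auto intro!: bound always_eventually)
qed

lemma Lp_norm_eq_infsum:
  assumes "test f"
  shows "Lp_norm N G p f = infsum (\<lambda>n. norm (f n) powr p) V powr (1 / p)"
proof -
  let ?S = "{n \<in> V. norm (f n) powr p \<noteq> 0}"
  have fin: "finite ?S"
    using assms unfolding test_function_def by (rule rev_finite_subset) auto
  then have "(\<integral>n. norm (f n) powr p \<partial>count_space V) = infsum (\<lambda>n. norm (f n) powr p) ?S"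
    by (simp add: lebesgue_integral_count_space_finite_support)
  also have "\<dots> = infsum (\<lambda>n. norm (f n) powr p) V"
    by (rule infsum_cong_neutral) auto
  finally show ?thesis by (simp add: Lp_norm_def)
qed

text \<open>For \<open>p < 2\<close> the conjugate exponent is at least 2, and symmetry of the
  energy exchanges \<open>f\<close> and \<open>g\<close>.\<close>

lemma energy_le_Lp_norm:
  assumes p: "1 < p" and q: "q = p / (p - 1)" and V: "countable V" and f: "test f" and g: "test g"
  shows "energy f g \<le> ennreal ((max p q - 1) * Lp_norm N G p f * Lp_norm N G q g)"
proof (cases "2 \<le> p")
  case True
  then have "q \<le> 2" by (simp add: q field_simps)
  then have "max p q = p" using True by simp
  then show ?thesis
    using energy_le_powr[OF True q V f g] by (simp add: Lp_norm_eq_infsum f g)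
next
  case False
  then have q2: "2 \<le> q" and pq: "p = q / (q - 1)" using p by (auto simp: q field_simps)
  have "max p q = q" using False q2 by simp
  then show ?thesis
    using energy_le_powr[OF q2 pq V g f] by (simp add: Lp_norm_eq_infsum f g energy_commute mult_ac)
qed

end

theorem theorem3:
  fixes G :: "int monoid" and N :: nat and p q pstar :: real
    and f g :: "(nat \<Rightarrow> int) \<Rightarrow> complex"
  assumes "G = integer_group \<or> (\<exists>m\<ge>2. G = integer_mod_group m)"
    and "N \<ge> 1"
    and "1 < p" and "q = p / (p - 1)" and "pstar = max p q"
    and "test_function N G f" and "test_function N G g"
  shows "2 * (\<Sum>i=1..N. \<integral>\<^sup>+t\<in>{0..}. (\<integral>\<^sup>+n.
            ennreal (norm (fwd_diff N G i (heat_ext N G f t) n)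
                   * norm (fwd_diff N G i (heat_ext N G g t) n))
          \<partial>count_space (carrier (gpow N G))) \<partial>lborel)
      \<le> ennreal ((pstar - 1) * Lp_norm N G p f * Lp_norm N G q g)"
proof -
  \<comment> \<open>The bound \<open>m \<ge> 2\<close> puts the generator 1 into
    \<open>{0..<m}\<close>.\<close>
  have "group G \<and> 1 \<in> carrier G"
    using assms(1) by (auto simp: carrier_integer_mod_group integer_group_def[symmetric])
  then interpret lattice_heat N G by (intro lattice_heat.intro) auto
  have "countable V"
    unfolding gpow_def carrier_product_group by (intro countable_PiE) auto
  from energy_le_Lp_norm[OF assms(3,4) this assms(6,7)] show ?thesis
    unfolding energy_def edge_def assms(5) .
qed

end
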